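(* Let $q$ be a prime power, $d\ge2$, let $\Lambda\subseteq\mathcal{K}_\infty^d$ be a lattice, let $\mathbf v^{(1)},\dots,\mathbf v^{(d)}\in\Lambda$ be a basis of successive minima for $\Lambda$ (linearly independent with $\|\mathbf v^{(i)}\|=\lambda_i(\Lambda)$), let $\mathcal{C}$ be a convex body and $N\in\mathbb{N}$. Let $\alpha=\sum_{i=1}^d\alpha_i\mathbf v^{(i)}$ with $\alpha_i\in\mathcal K_\infty$ such that $\mathcal{R}_{\le N}\alpha_i\cap\mathcal{R}=\{0\}$ for every $i=1,\dots,d$. Then $$d(\Lambda(\alpha,q^N))\frac{\det(\Lambda)}{m(\mathcal C)}\le\prod_{i=1}^d\lambda_{i,\mathcal{C}}(\Lambda(\alpha,q^N))\le\frac{\det(\Lambda)}{q^{N+1}m(\mathcal{C})},$$ where $$d(\Lambda(\alpha,q^N))=\min_{k=1,\dots,d}\ \min_{\{j_1<\dots<j_k\}\subseteq\{1,\dots,d\}}\Big\{\big|\det\big(\langle Q_i\alpha_{j_\ell}\rangle\big)_{1\le i,\ell\le k}\big|>0:\ Q_1,\dots,Q_k\in\mathcal R_{\le N}\Big\}.$$ As a consequence, there exist $k\in\{1,\dots,d\}$, indices $1\le\ell_1<\dots<\ell_k\le d$ and polynomials $Q_1,\dots,Q_k\in\mathcal{R}_{\le N}$ such that $$0\ne\left|\det\begin{pmatrix}\langle Q_1\alpha_{\ell_1}\rangle&\cdots&\langle Q_k\alpha_{\ell_1}\rangle\\ \vdots&&\vdots\\ \langle Q_1\alpha_{\ell_k}\rangle&\cdots&\langle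 Q_k\alpha_{\ell_k}\rangle\end{pmatrix}\right|\le\frac1{q^{N+1}}.$$
   Context: $\mathcal{R}=\mathbb{F}_q[x]$, $\mathcal R_{\le N}=\{Q\in\mathcal R:\deg Q\le N\}$ (including $0$), $\mathcal{K}_\infty=\mathbb{F}_q((x^{-1}))$ with absolute value $|f/g|=q^{\deg f-\deg g}$, $\mathcal{O}=\mathbb{F}_q[[x^{-1}]]$, $\mathfrak{m}=x^{-1}\mathcal{O}$; $m$ is the Haar measure on $\mathcal{K}_\infty^d$ with $m(\mathcal O^d)=1$. For $\beta\in\mathcal K_\infty$, $\langle\beta\rangle$ is the unique element of $\mathfrak m$ with $\beta-\langle\beta\rangle\in\mathcal R$. $\|\mathbf v\|=\max_i|v_i|$. A convex body is $\mathcal{C}=h\mathcal{O}^d$, $h\in\operatorname{GL}_d(\mathcal{K}_\infty)$, with norm $\|\mathbf v\|_{\mathcal C}=\max_i|(h^{-1}\mathbf v)_i|$. A lattice is $\Lambda=g\mathcal{R}^d$ with $\det(\Lambda)=|\det g|$. Successive minima: $\lambda_{i,\mathcal{C}}(S)=\min\{r>0:\dim\operatorname{span}_{\mathcal{K}_\infty}(S\cap\{\|\mathbf{v}\|_{\mathcal{C}}\le r\})\ge i\}$, and $\lambda_i=\lambda_{i,\mathcal O^d}$. For $N\in\mathbb N$, $\Lambda(\alpha,q^N)=\bigcup_{Q\in\mathcal R_{\le N}}(Q\alpha+\Lambda)$.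
   Formalization: Assumes α ≠ 0 (for α = 0 the upper bound and the consequence fail), and the lower bound is claimed only when the v^(i) realize the successive minima of Λ with respect to C (automatic for C = O^d); for a general C with v adapted to O^d it is false. *)

theory Defs
  imports "HOL-Analysis.Analysis" "HOL-Computational_Algebra.Computational_Algebra"
    "Jordan_Normal_Form.Determinant"
begin

text \<open>
  The field with \<open>q\<close> elements is a type \<open>'a :: {field, finite}\<close> with \<open>q = CARD('a)\<close>.  The completion
  of its rational function field at infinity is \<open>'a fls\<close>, the Laurent series in the uniformizer
  \<open>fls_X = 1/x\<close>; thus \<open>x\<close> itself is \<open>fls_X_inv\<close>.  The library topology on \<open>'a fls\<close> is the
  one given by the absolute value below, and \<open>'a fls ^ 'd\<close> carries the product topology,
  with \<open>d = CARD('d)\<close>.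
\<close>

definition poly_embed :: "'a::{field,finite} poly \<Rightarrow> 'a fls" where
  "poly_embed p = poly (map_poly fls_const p) fls_X_inv"

definition ring_R :: "'a::{field,finite} fls set" where
  "ring_R = range poly_embed"

text \<open>\<open>degree 0 = 0\<close> in the library, so the zero polynomial is included.\<close>

definition polys_le :: "nat \<Rightarrow> 'a::{field,finite} poly set" where
  "polys_le N = {Q. degree Q \<le> N}"

definition ring_O :: "'a::{field,finite} fls set" where
  "ring_O = range fps_to_fls"

definition max_ideal :: "'a::{field,finite} fls set" where
  "max_ideal = (\<lambda>f. fls_X * f) ` ring_O"

text \<open>The order in \<open>1/x\<close> of a quotient of polynomials \<open>f / g\<close> is \<open>deg g - deg f\<close>.\<close>

definition absK :: "'a::{field,finite} fls \<Rightarrow> real" where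
  "absK f = (if f = 0 then 0 else real CARD('a) powi (- fls_subdegree f))"

definition frac_part :: "'a::{field,finite} fls \<Rightarrow> 'a fls" where
  "frac_part \<beta> = (THE \<mu>. \<mu> \<in> max_ideal \<and> \<beta> - \<mu> \<in> ring_R)"

definition supnorm :: "'a::{field,finite} fls ^ 'd \<Rightarrow> real" where
  "supnorm v = Max (range (\<lambda>i. absK (v $ i)))"

definition unit_body :: "('a::{field,finite} fls ^ 'd) set" where
  "unit_body = {v. \<forall>i. v $ i \<in> ring_O}"

text \<open>
  Convex bodies and lattices are represented by a matrix in \<open>GL\<^sub>d\<close>; invertibility is
  assumed where they are used.
\<close>

definition convex_body :: "'a::{field,finite} fls ^ 'd ^ 'd \<Rightarrow> ('a fls ^ 'd) set" where
  "convex_body h = (\<lambda>v. h *v v) ` unit_body"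

definition body_norm :: "'a::{field,finite} fls ^ 'd ^ 'd \<Rightarrow> 'a fls ^ 'd \<Rightarrow> real" where
  "body_norm h v = supnorm (matrix_inv h *v v)"

definition lattice_of :: "'a::{field,finite} fls ^ 'd ^ 'd \<Rightarrow> ('a fls ^ 'd) set" where
  "lattice_of g = (\<lambda>v. g *v v) ` {v. \<forall>i. v $ i \<in> ring_R}"

definition lattice_det :: "'a::{field,finite} fls ^ 'd ^ 'd \<Rightarrow> real" where
  "lattice_det g = absK (Determinants.det g)"

definition succ_min ::
  "'a::{field,finite} fls ^ 'd ^ 'd \<Rightarrow> ('a fls ^ 'd) set \<Rightarrow> nat \<Rightarrow> real" where
  "succ_min h S i =
     (LEAST r. r > 0 \<and> vec.dim (vec.span (S \<inter> {v. body_norm h v \<le> r})) \<ge> i)"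

text \<open>
  The body is a parameter because the lower bound of the theorem fails in general for a basis
  realising the minima of \<open>\<O>\<^sup>d\<close> instead of those of the body in question: for \<open>\<Lambda> = \<R>\<^sup>2\<close>,
  \<open>v\<close> the standard basis, \<open>h\<close> with rows \<open>(x, 1)\<close>, \<open>(x\<^sup>2 - 1, x)\<close>, \<open>\<alpha> = h (t, t)\<close> and
  \<open>t = x\<close> to a large negative power, the product of the minima is \<open>|t|\<close>, but the smallest
  nonzero minor is \<open>q |t|\<close>.
\<close>

definition succ_min_basis ::
  "'a::{field,finite} fls ^ 'd ^ 'd \<Rightarrow> ('a fls ^ 'd) set \<Rightarrow> (nat \<Rightarrow> 'a fls ^ 'd) \<Rightarrow> bool" where
  "succ_min_basis h L v \<longleftrightarrow>
     (\<forall>i\<in>{1..CARD('d)}. v i \<in> L) \<and>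
     inj_on v {1..CARD('d)} \<and> vec.independent (v ` {1..CARD('d)}) \<and>
     (\<forall>i\<in>{1..CARD('d)}. body_norm h (v i) = succ_min h L i)"

text \<open>The body \<open>\<O>\<^sup>d\<close> and the maximum norm are those of the identity matrix.\<close>

lemma convex_body_mat_1: "convex_body (Finite_Cartesian_Product.mat 1) = unit_body"
  by (simp add: convex_body_def)

lemma matrix_inv_mat_1:
  "matrix_inv (Finite_Cartesian_Product.mat 1 :: 'a::{field,finite} fls ^ 'd ^ 'd) =
     Finite_Cartesian_Product.mat 1"
proof -
  let ?I = "Finite_Cartesian_Product.mat 1 :: 'a fls ^ 'd ^ 'd"
  have "\<exists>A'. ?I ** A' = ?I \<and> A' ** ?I = ?I"
    by (rule exI[of _ ?I]) simp
  hence "?I ** matrix_inv ?I = ?I \<and> matrix_inv ?I ** ?I = ?I"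
    unfolding matrix_inv_def by (rule someI_ex)
  thus ?thesis by simp
qed

lemma body_norm_mat_1: "body_norm (Finite_Cartesian_Product.mat 1) v = supnorm v"
  by (simp add: body_norm_def matrix_inv_mat_1)

text \<open>
  A Haar measure is automatically finite on compact sets here, because the compact open group
  \<open>\<O>\<^sup>d\<close> has measure 1; so these conditions characterise the normalised Haar measure.
\<close>

definition haar_measure :: "('a::{field,finite} fls ^ 'd) measure \<Rightarrow> bool" where
  "haar_measure M \<longleftrightarrow>
     sets M = sets borel \<and>
     (\<forall>a. \<forall>A\<in>sets borel. emeasure M ((\<lambda>v. a + v) ` A) = emeasure M A) \<and>
     emeasure M unit_body = 1"

text \<open>\<open>kronecker_set L \<alpha> N\<close> is \<open>\<Lambda>(\<alpha>, q\<^sup>N)\<close>.\<close>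

definition kronecker_set ::
  "('a::{field,finite} fls ^ 'd) set \<Rightarrow> 'a fls ^ 'd \<Rightarrow> nat \<Rightarrow> ('a fls ^ 'd) set" where
  "kronecker_set L \<alpha> N = (\<Union>Q\<in>polys_le N. (\<lambda>u. poly_embed Q *s \<alpha> + u) ` L)"

text \<open>
  A choice \<open>j\<^sub>1 < \<dots> < j\<^sub>k\<close> in \<open>{1..d}\<close> is a function \<open>j\<close> on \<open>{1..k}\<close>.  Matrices are 0-based in the
  library, whence the \<open>Suc\<close>.
\<close>

definition index_choice :: "nat \<Rightarrow> nat \<Rightarrow> (nat \<Rightarrow> nat) \<Rightarrow> bool" where
  "index_choice d k j \<longleftrightarrow> strict_mono_on {1..k} j \<and> j ` {1..k} \<subseteq> {1..d}"

definition frac_matrix ::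
  "nat \<Rightarrow> (nat \<Rightarrow> 'a::{field,finite} poly) \<Rightarrow> (nat \<Rightarrow> 'a fls) \<Rightarrow> (nat \<Rightarrow> nat) \<Rightarrow> 'a fls mat" where
  "frac_matrix k Q a j =
     Matrix.mat k k (\<lambda>(i, l). frac_part (poly_embed (Q (Suc i)) * a (j (Suc l))))"

text \<open>
  The iterated minimum skips those index sets for which every determinant vanishes, so it is the
  minimum of all nonzero values.
\<close>

definition min_minor :: "nat \<Rightarrow> (nat \<Rightarrow> 'a::{field,finite} fls) \<Rightarrow> nat \<Rightarrow> real" where
  "min_minor d a N = Min {r. r > 0 \<and> (\<exists>k\<in>{1..d}. \<exists>j Q. index_choice d k j \<and>
     (\<forall>i\<in>{1..k}. Q i \<in> polys_le N) \<and> r = absK (Determinant.det (frac_matrix k Q a j)))}"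

end

(*
  After multiplication by the inverse of h the body is the unit body. The upper bound is Minkowski's
  packing argument, which only needs S = Lambda(alpha, q^N) to be an additive group: for greedily
  chosen s_1, ..., s_d in S realising the minima, a pivoted elimination gives a basis of the flag of
  spans that is orthonormal for the maximum norm; the box with side lengths lambda_i along this basis
  meets S only in 0, hence its translates by the q^(N+1) classes of S modulo Lambda pack the torus.
  For the lower bound, a basis realising the minima of Lambda is orthogonal, so the minima of S are
  attained by basis vectors and by the vectors of fractional parts of Q alpha. If k vectors of the
  second kind occur, Hadamard's inequality applied to their minor in the remaining k coordinates
  bounds the product of the minima from below.
*)
theory Submission
  imports Defs
begin

text \<open>Minkowski's bound costs no constant here because the unit ball is a group: two points of
  a translated box differ by a point of the same box. For \<Lambda> itself the upper bound therefore
  meets Hadamard's lower bound exactly, which is where orthogonality comes from. The factor q^(N+1)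
  counts the classes Q \<alpha> + \<Lambda>, so these must be distinct. The condition on the
  coefficients also admits zeros, whence \<alpha> \<noteq> 0: for \<alpha> = 0 the set is \<Lambda>,
  the upper bound is false and every minor vanishes. Distinctness does not involve the body, so the
  upper bound passes to every body. The lower bound uses orthogonality in the norm of a body whose
  minima the basis realises, and the estimate of a single minor comes from comparing both bounds in
  such a body. The volume of h O^d is computed by column operations, down to the fact that the
  maximal ideal has q cosets in O.\<close>

no_notation Matrix.vec_index (infixl "$" 100)
no_notation fps_nth (infixl "$" 75)

subsection \<open>The absolute value and the ring of polynomials\<close>

lemma card_field_gt_1: "1 < CARD('a::{field,finite})"
proof -
  have "card {0, 1 :: 'a} \<le> CARD('a)" by (intro card_mono) auto
  thus ?thesis by simp
qed

lemma absK_0 [simp]: "absK (0::'a::{field,finite} fls) = 0"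
  by (simp add: absK_def)

lemma absK_eq_0_iff [simp]: "absK f = 0 \<longleftrightarrow> f = 0"
  using card_field_gt_1[where 'a='a] by (auto simp: absK_def)

lemma absK_nonneg [simp]: "0 \<le> absK (f :: 'a::{field,finite} fls)"
  by (simp add: absK_def)

lemma absK_pos_iff [simp]: "0 < absK (f :: 'a::{field,finite} fls) \<longleftrightarrow> f \<noteq> 0"
  by (simp add: order.strict_iff_order)

lemma absK_1 [simp]: "absK (1::'a::{field,finite} fls) = 1"
  by (simp add: absK_def)

lemma absK_minus [simp]: "absK (- f) = absK (f :: 'a::{field,finite} fls)"
  by (simp add: absK_def)

lemma absK_mult [simp]: "absK (f * g) = absK f * absK (g :: 'a::{field,finite} fls)"
  using card_field_gt_1[where 'a='a] by (auto simp: absK_def power_int_diff divide_simps power_int_minus)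

lemma absK_inverse [simp]: "absK (inverse f) = inverse (absK (f :: 'a::{field,finite} fls))"
  using card_field_gt_1[where 'a='a] by (auto simp: absK_def power_int_minus)

lemma absK_divide [simp]: "absK (f / g) = absK f / absK (g :: 'a::{field,finite} fls)"
  by (simp add: divide_inverse)

lemma absK_power [simp]: "absK (f ^ n) = absK (f :: 'a::{field,finite} fls) ^ n"
  by (induction n) auto

lemma absK_prod: "absK (\<Prod>i\<in>A. f i) = (\<Prod>i\<in>A. absK (f i :: 'a::{field,finite} fls))"
  by (induction A rule: infinite_finite_induct) auto

text \<open>The order of a series falls as its absolute value grows. \<open>f = 0\<close> and
  \<open>g \<noteq> 0\<close> are treated apart because \<open>fls_subdegree 0\<close> is 0, not
  infinity.\<close>

lemma absK_le_iff:
  fixes f g :: "'a::{field,finite} fls"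
  assumes "g \<noteq> 0"
  shows "absK f \<le> absK g \<longleftrightarrow> f = 0 \<or> fls_subdegree g \<le> fls_subdegree f"
proof (cases "f = 0")
  case False
  have "fls_subdegree f < fls_subdegree g \<Longrightarrow> absK g < absK f"
    using card_field_gt_1[where 'a='a] assms False by (auto simp: absK_def intro!: power_int_strict_increasing)
  moreover have "fls_subdegree g \<le> fls_subdegree f \<Longrightarrow> absK f \<le> absK g"
    using card_field_gt_1[where 'a='a] assms False by (auto simp: absK_def intro!: power_int_increasing)
  ultimately show ?thesis using False by force
qed auto

lemma absK_add_le_max: "absK (f + g) \<le> max (absK f) (absK (g :: 'a::{field,finite} fls))"
proof (cases "f = 0 \<or> g = 0 \<or> f + g = 0")
  case True
  thus ?thesis by (auto simp: le_max_iff_disj)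
next
  case False
  thus ?thesis using fls_plus_subdegree[of f g] by (auto simp: le_max_iff_disj absK_le_iff)
qed

lemma absK_diff_le_max: "absK (f - g) \<le> max (absK f) (absK (g :: 'a::{field,finite} fls))"
  using absK_add_le_max[of f "-g"] by simp

lemma absK_add_less: "absK f < c \<Longrightarrow> absK g < c \<Longrightarrow> absK (f + g :: 'a::{field,finite} fls) < c"
  using absK_add_le_max[of f g] by simp

lemma absK_sum_le:
  assumes "\<And>i. i \<in> A \<Longrightarrow> absK (f i :: 'a::{field,finite} fls) \<le> c" "0 \<le> c"
  shows "absK (\<Sum>i\<in>A. f i) \<le> c"
  using assms
proof (induction A rule: infinite_finite_induct)
  case (insert x A)
  have "absK (f x + sum f A) \<le> max (absK (f x)) (absK (sum f A))" by (rule absK_add_le_max)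
  also have "\<dots> \<le> c" using insert by auto
  finally show ?case using insert by simp
qed auto

lemma absK_sum_less:
  assumes "\<And>i. i \<in> A \<Longrightarrow> absK (f i :: 'a::{field,finite} fls) < c" "0 < c"
  shows "absK (\<Sum>i\<in>A. f i) < c"
  using assms by (induction A rule: infinite_finite_induct) (auto intro: absK_add_less)

text \<open>The isosceles property of an ultrametric: a strictly dominant summand decides the size.
  Later this summand is a pivot entry, or a nonzero polynomial next to a fractional part.\<close>

lemma absK_add_eq:
  assumes "absK g < absK (f :: 'a::{field,finite} fls)"
  shows "absK (f + g) = absK f"
proof -
  have "absK (f + g) \<le> absK f" using absK_add_le_max[of f g] assms by simp
  moreover have "absK f \<le> max (absK (f + g)) (absK g)" using absK_diff_le_max[of "f + g" g] by simp
  ultimately show ?thesis using assms by auto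
qed

lemma absK_fls_X [simp]: "absK (fls_X :: 'a::{field,finite} fls) = inverse (real CARD('a))"
  by (simp add: absK_def power_int_minus)

lemma absK_fls_X_inv [simp]: "absK (fls_X_inv :: 'a::{field,finite} fls) = real CARD('a)"
  by (simp add: absK_def)

lemma absK_fls_const [simp]: "c \<noteq> 0 \<Longrightarrow> absK (fls_const (c::'a::{field,finite})) = 1"
  by (simp add: absK_def fls_const_nonzero)

lemma ex_absK_eq_fls_X_powi:
  assumes "z \<noteq> (0::'a::{field,finite} fls)"
  obtains n where "absK z = absK (fls_X powi n :: 'a fls)"
proof
  show "absK z = absK (fls_X powi (fls_subdegree z) :: 'a fls)"
    using assms by (simp add: absK_def power_int_minus power_int_inverse)
qed

lemma mem_ring_O_iff: "f \<in> ring_O \<longleftrightarrow> absK (f :: 'a::{field,finite} fls) \<le> 1"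
proof -
  have "f \<in> ring_O \<longleftrightarrow> 0 \<le> fls_subdegree f"
  proof
    assume "0 \<le> fls_subdegree f"
    hence "f = fps_to_fls (fls_regpart f)" by simp
    thus "f \<in> ring_O" unfolding ring_O_def by blast
  qed (auto simp: ring_O_def fls_subdegree_fls_to_fps_gt0)
  thus ?thesis using absK_le_iff[of 1 f] by auto
qed

text \<open>The value group is discrete: nothing lies strictly between 1/q and 1. Strict bounds thus
  become closed ones, which relates the open unit ball to a scaled unit body.\<close>

lemma absK_less_1_iff: "absK (f :: 'a::{field,finite} fls) < 1 \<longleftrightarrow> absK f \<le> absK (fls_X :: 'a::{field,finite} fls)"
proof -
  have "absK f < 1 \<longleftrightarrow> \<not> absK (1 :: 'a fls) \<le> absK f" by auto
  also have "\<dots> \<longleftrightarrow> f = 0 \<or> fls_subdegree (fls_X :: 'a fls) \<le> fls_subdegree f"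
  proof (cases "f = 0")
    case False
    thus ?thesis unfolding absK_le_iff[OF False] by auto
  qed simp
  also have "\<dots> \<longleftrightarrow> absK f \<le> absK (fls_X :: 'a fls)" by (rule absK_le_iff[symmetric]) simp
  finally show ?thesis .
qed

lemma mem_max_ideal_iff: "f \<in> max_ideal \<longleftrightarrow> absK (f :: 'a::{field,finite} fls) < 1"
proof
  assume "f \<in> max_ideal"
  then obtain g where "f = fls_X * g" "absK g \<le> 1" by (auto simp: max_ideal_def mem_ring_O_iff)
  thus "absK f < 1"
    unfolding absK_less_1_iff using card_field_gt_1[where 'a='a] by (simp add: field_simps)
next
  assume "absK f < 1"
  hence "absK f \<le> absK (fls_X :: 'a fls)" by (simp only: absK_less_1_iff)
  hence "absK (f / fls_X) \<le> 1"
    unfolding absK_divide by (simp add: field_simps)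
  hence "f / fls_X \<in> ring_O" by (simp only: mem_ring_O_iff)
  moreover have "f = fls_X * (f / fls_X)" by (metis fls_X_nonzero nonzero_mult_div_cancel_left times_divide_eq_right)
  ultimately show "f \<in> max_ideal" unfolding max_ideal_def by blast
qed

section \<open>Polynomials in x as Laurent series in 1/x\<close>

lemma poly_embed_0 [simp]: "poly_embed 0 = 0"
  by (simp add: poly_embed_def)

lemma poly_embed_pCons: "poly_embed (pCons a p) = fls_const a + fls_X_inv * poly_embed p"
  by (simp add: poly_embed_def map_poly_pCons)

lemma poly_embed_1 [simp]: "poly_embed 1 = 1"
  by (simp add: one_pCons poly_embed_pCons)

lemma poly_embed_add: "poly_embed (p + r) = poly_embed p + poly_embed r"
  by (induction p r rule: poly_induct2) (simp_all add: poly_embed_pCons fls_plus_const algebra_simps)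

lemma poly_embed_smult: "poly_embed (Polynomial.smult c p) = fls_const c * poly_embed p"
  by (induction p) (simp_all add: poly_embed_pCons algebra_simps fls_const_mult_const)

lemma poly_embed_mult: "poly_embed (p * r) = poly_embed p * poly_embed r"
  by (induction p) (simp_all add: poly_embed_pCons poly_embed_add poly_embed_smult algebra_simps)

lemma poly_embed_minus: "poly_embed (- p) = - poly_embed p"
  using poly_embed_add[of p "- p"] by (simp add: eq_neg_iff_add_eq_0 add.commute)

lemma poly_embed_diff: "poly_embed (p - r) = poly_embed p - poly_embed r"
  using poly_embed_add[of p "- r"] by (simp add: poly_embed_minus)

lemma poly_embed_nth:
  "fls_nth (poly_embed p) k = (if k \<le> 0 then poly.coeff p (nat (- k)) else 0)"
proof (induction p arbitrary: k)
  case 0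
  thus ?case by simp
next
  case (pCons a p)
  show ?case
    by (auto simp: poly_embed_pCons fls_X_inv_times_conv_shift pCons.IH coeff_pCons
        nat_diff_distrib split: nat.splits)
qed

lemma poly_embed_eq_0_iff [simp]: "poly_embed p = 0 \<longleftrightarrow> p = 0"
proof
  assume "poly_embed p = 0"
  hence "\<forall>k. fls_nth (poly_embed p) (- int k) = 0" by simp
  thus "p = 0" by (auto simp: poly_embed_nth poly_eq_iff)
qed simp

lemma absK_poly_embed: "p \<noteq> 0 \<Longrightarrow> absK (poly_embed p) = real CARD('a) ^ degree (p :: 'a::{field,finite} poly)"
proof -
  assume p: "p \<noteq> 0"
  have "fls_subdegree (poly_embed p) = - int (degree p)"
    using p by (intro fls_subdegree_eqI) (auto simp: poly_embed_nth coeff_eq_0)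
  thus ?thesis using p by (simp add: absK_def)
qed

lemma ring_R_0 [simp]: "0 \<in> ring_R" and ring_R_1 [simp]: "1 \<in> ring_R"
  unfolding ring_R_def by (auto intro: range_eqI[of _ _ 0] range_eqI[of _ _ 1])

lemma ring_R_poly_embed [simp]: "poly_embed p \<in> ring_R"
  by (simp add: ring_R_def)

lemma ring_R_add: "f \<in> ring_R \<Longrightarrow> g \<in> ring_R \<Longrightarrow> f + g \<in> ring_R"
  by (auto simp: ring_R_def simp flip: poly_embed_add)

lemma ring_R_mult: "f \<in> ring_R \<Longrightarrow> g \<in> ring_R \<Longrightarrow> f * g \<in> ring_R"
  by (auto simp: ring_R_def simp flip: poly_embed_mult)

lemma ring_R_minus: "f \<in> ring_R \<Longrightarrow> - f \<in> ring_R"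
  by (auto simp: ring_R_def simp flip: poly_embed_minus)

lemma ring_R_diff: "f \<in> ring_R \<Longrightarrow> g \<in> ring_R \<Longrightarrow> f - g \<in> ring_R"
  by (auto simp: ring_R_def simp flip: poly_embed_diff)

lemma ring_R_sum: "(\<And>i. i \<in> A \<Longrightarrow> f i \<in> ring_R) \<Longrightarrow> (\<Sum>i\<in>A. f i) \<in> ring_R"
  by (induction A rule: infinite_finite_induct) (auto intro: ring_R_add)

lemma ring_R_prod: "(\<And>i. i \<in> A \<Longrightarrow> f i \<in> ring_R) \<Longrightarrow> (\<Prod>i\<in>A. f i) \<in> ring_R"
  by (induction A rule: infinite_finite_induct) (auto intro: ring_R_mult)

lemma ring_R_absK_ge_1: "f \<in> ring_R \<Longrightarrow> f \<noteq> 0 \<Longrightarrow> 1 \<le> absK (f :: 'a::{field,finite} fls)"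
  using card_field_gt_1[where 'a='a] by (auto simp: ring_R_def absK_poly_embed)

text \<open>Absolute value 1 means degree 0, so \<open>f\<close> is a nonzero constant. Applied to a
  determinant, this keeps Cramer's rule within the polynomials.\<close>

lemma ring_R_inverse:
  fixes f :: "'a::{field,finite} fls"
  assumes "f \<in> ring_R" "absK f = 1"
  shows "inverse f \<in> ring_R"
proof -
  obtain p where p: "f = poly_embed p" using assms by (auto simp: ring_R_def)
  have "degree p = 0"
    using assms card_field_gt_1[where 'a='a] absK_poly_embed[of p] p
      one_less_power[of "real CARD('a)" "degree p"]
    by (cases "p = 0") force+
  then obtain c where c: "p = [:c:]" by (rule degree_eq_zeroE)
  have "inverse f = poly_embed [:inverse c:]"
    using c p by (simp add: poly_embed_pCons fls_inverse_const)
  thus ?thesis by simp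
qed

section \<open>Fractional parts\<close>

lemma ex_ring_R_diff_max_ideal:
  fixes f :: "'a::{field,finite} fls"
  shows "\<exists>r\<in>ring_R. absK (f - r) < 1"
proof -
  \<comment> \<open>The coefficients at the indices -n, ..., 0 form the polynomial part; the
    constant term belongs to it, hence \<open>Suc n\<close> entries. For positive order
    \<open>nat\<close> gives n = 0, and \<open>p\<close> is 0.\<close>
  define n where "n = nat (- fls_subdegree f)"
  define p where "p = Poly (map (\<lambda>k. fls_nth f (- int k)) [0..<Suc n])"
  have "fls_nth f k = 0" if "k < - int n" for k
    using that by (intro fls_eq0_below_subdegree) (auto simp: n_def split: if_splits)
  hence nth: "fls_nth (poly_embed p) k = fls_nth f k" if "k \<le> 0" for k
    using that by (auto simp: poly_embed_nth p_def nth_default_def simp del: upt_Suc)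
  have "f - poly_embed p = 0 \<or> 0 < fls_subdegree (f - poly_embed p)"
    using nth by (auto intro!: fls_subdegree_greaterI)
  hence "absK (f - poly_embed p) < 1"
    using absK_le_iff[of fls_X "f - poly_embed p"] by (auto simp: absK_less_1_iff)
  thus ?thesis by (rule bexI) simp
qed

text \<open>Two candidates differ by a polynomial of absolute value below 1, and a nonzero
  polynomial has absolute value at least 1.\<close>

lemma frac_part_unique:
  fixes f :: "'a::{field,finite} fls"
  assumes "absK \<mu> < 1" "f - \<mu> \<in> ring_R" "absK \<nu> < 1" "f - \<nu> \<in> ring_R"
  shows "\<mu> = \<nu>"
proof (rule ccontr)
  assume "\<mu> \<noteq> \<nu>"
  moreover have "\<mu> - \<nu> \<in> ring_R" using ring_R_diff[OF assms(4,2)] by simp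
  ultimately have "1 \<le> absK (\<mu> - \<nu>)" by (intro ring_R_absK_ge_1) auto
  thus False using absK_diff_le_max[of \<mu> \<nu>] assms by simp
qed

lemma absK_frac_part: "absK (frac_part f) < 1"
  and diff_frac_part: "f - frac_part f \<in> ring_R"
proof -
  have "\<exists>!\<mu>. \<mu> \<in> max_ideal \<and> f - \<mu> \<in> ring_R"
  proof -
    obtain r where "r \<in> ring_R" "absK (f - r) < 1" using ex_ring_R_diff_max_ideal by blast
    thus ?thesis
      by (intro ex1I[of _ "f - r"]) (auto simp: mem_max_ideal_iff intro: frac_part_unique)
  qed
  from theI'[OF this] show "absK (frac_part f) < 1" "f - frac_part f \<in> ring_R"
    by (auto simp: frac_part_def mem_max_ideal_iff)
qed

section \<open>Polynomials of bounded degree\<close>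

lemma polys_le_Suc:
  "polys_le (Suc N) = (\<lambda>(c, p). pCons c p) ` (UNIV \<times> polys_le N)"
proof (intro equalityI subsetI)
  fix p :: "'a poly" assume "p \<in> polys_le (Suc N)"
  thus "p \<in> (\<lambda>(c, p). pCons c p) ` (UNIV \<times> polys_le N)"
    by (cases p) (auto simp: polys_le_def image_iff split: if_splits)
qed (auto simp: polys_le_def degree_pCons_le split: if_splits)

text \<open>Degree at most N leaves N + 1 free coefficients; this is the source of the exponent in
  q^(N+1).\<close>

lemma finite_polys_le [simp]: "finite (polys_le N :: 'a::{field,finite} poly set)"
  and card_polys_le: "card (polys_le N :: 'a::{field,finite} poly set) = CARD('a) ^ (N + 1)"
proof (induction N)
  case 0
  have eq: "(polys_le 0 :: 'a poly set) = range (\<lambda>c. [:c:])"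
    by (auto simp: polys_le_def elim: degree_eq_zeroE)
  { case 1 show ?case by (simp add: eq) }
  { case 2 show ?case by (simp add: eq card_image inj_def) }
next
  case (Suc N)
  { case 1 show ?case using Suc by (simp add: polys_le_Suc) }
  { case 2 show ?case using Suc
      by (simp add: polys_le_Suc card_image inj_on_def card_cartesian_product) }
qed

lemma polys_le_0 [simp]: "0 \<in> polys_le N"
  by (simp add: polys_le_def)

lemma polys_le_diff: "p \<in> polys_le N \<Longrightarrow> r \<in> polys_le N \<Longrightarrow> p - r \<in> polys_le N"
  by (auto simp: polys_le_def intro: degree_diff_le)

lemma finite_ring_R_bounded: "finite {f :: 'a::{field,finite} fls. f \<in> ring_R \<and> absK f \<le> r}"
proof -
  obtain N where N: "r < real CARD('a) ^ N"
    using real_arch_pow[of "real CARD('a)" r] card_field_gt_1[where 'a='a] by auto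
  have "{f :: 'a fls. f \<in> ring_R \<and> absK f \<le> r} \<subseteq> poly_embed ` polys_le N"
  proof safe
    fix f :: "'a fls" assume "f \<in> ring_R" "absK f \<le> r"
    then obtain p where p: "f = poly_embed p" by (auto simp: ring_R_def)
    have "p \<in> polys_le N"
    proof (cases "p = 0")
      case False
      hence "real CARD('a) ^ degree p < real CARD('a) ^ N"
        using \<open>absK f \<le> r\<close> N by (simp add: p absK_poly_embed)
      thus ?thesis using card_field_gt_1[where 'a='a] by (auto simp: polys_le_def)
    qed simp
    thus "f \<in> poly_embed ` polys_le N" using p by blast
  qed
  thus ?thesis by (rule finite_subset) simp
qed

lemma countable_ring_R: "countable (ring_R :: 'a::{field,finite} fls set)"
proof -
  have "ring_R \<subseteq> (\<Union>N. poly_embed ` (polys_le N :: 'a poly set))"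
    by (auto simp: ring_R_def polys_le_def)
  thus ?thesis by (rule countable_subset) (rule countable_UN, simp, simp add: countable_finite)
qed

subsection \<open>The maximum norm and determinants\<close>

abbreviation "fdet \<equiv> Determinants.det"
lemma absK_le_0_iff [simp]: "absK f \<le> 0 \<longleftrightarrow> f = (0 :: 'a::{field,finite} fls)"
  by (metis absK_eq_0_iff absK_nonneg order.antisym order_refl)

lemma supnorm_le_iff:
  fixes x :: "'a::{field,finite} fls ^ 'd"
  shows "supnorm x \<le> r \<longleftrightarrow> (\<forall>i. absK (x $ i) \<le> r)"
  by (auto simp: supnorm_def)

lemma supnorm_less_iff:
  fixes x :: "'a::{field,finite} fls ^ 'd"
  shows "supnorm x < r \<longleftrightarrow> (\<forall>i. absK (x $ i) < r)"
  by (auto simp: supnorm_def)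

lemma absK_nth_le_supnorm: "absK (x $ i) \<le> supnorm (x :: 'a::{field,finite} fls ^ 'd)"
  using supnorm_le_iff[of x "supnorm x"] by simp

lemma ex_absK_nth_eq_supnorm:
  obtains i where "supnorm (x :: 'a::{field,finite} fls ^ 'd) = absK (x $ i)"
proof -
  have "supnorm x \<in> range (\<lambda>i. absK (x $ i))"
    unfolding supnorm_def by (rule Max_in) auto
  thus ?thesis using that by auto
qed

lemma supnorm_nonneg [simp]: "0 \<le> supnorm (x :: 'a::{field,finite} fls ^ 'd)"
  by (metis ex_absK_nth_eq_supnorm absK_nonneg)

lemma supnorm_eq_0_iff [simp]: "supnorm x = 0 \<longleftrightarrow> (x :: 'a::{field,finite} fls ^ 'd) = 0"
  using supnorm_le_iff[of x 0] by (auto simp: Finite_Cartesian_Product.vec_eq_iff order.antisym)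

lemma supnorm_0 [simp]: "supnorm (0 :: 'a::{field,finite} fls ^ 'd) = 0"
  by simp

lemma supnorm_pos_iff [simp]: "0 < supnorm (x :: 'a::{field,finite} fls ^ 'd) \<longleftrightarrow> x \<noteq> 0"
  by (simp add: order.strict_iff_order)

lemma supnorm_scale [simp]:
  "supnorm (c *s x) = absK c * supnorm (x :: 'a::{field,finite} fls ^ 'd)"
proof (rule antisym)
  show "supnorm (c *s x) \<le> absK c * supnorm x"
    by (simp add: supnorm_le_iff absK_nth_le_supnorm mult_left_mono)
  obtain i where "supnorm x = absK (x $ i)" by (rule ex_absK_nth_eq_supnorm)
  thus "absK c * supnorm x \<le> supnorm (c *s x)"
    using absK_nth_le_supnorm[of "c *s x" i] by simp
qed

lemma supnorm_minus [simp]: "supnorm (- x) = supnorm (x :: 'a::{field,finite} fls ^ 'd)"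
  by (simp add: supnorm_def)

lemma supnorm_add_le_max:
  "supnorm (x + y) \<le> max (supnorm x) (supnorm (y :: 'a::{field,finite} fls ^ 'd))"
  unfolding supnorm_le_iff
proof
  fix i
  show "absK ((x + y) $ i) \<le> max (supnorm x) (supnorm y)"
    using absK_add_le_max[of "x $ i" "y $ i"] absK_nth_le_supnorm[of x i] absK_nth_le_supnorm[of y i]
    by (auto simp: le_max_iff_disj)
qed

lemma supnorm_diff_le_max:
  "supnorm (x - y) \<le> max (supnorm x) (supnorm (y :: 'a::{field,finite} fls ^ 'd))"
  using supnorm_add_le_max[of x "- y"] by simp

lemma supnorm_sum_le:
  assumes "\<And>i. i \<in> A \<Longrightarrow> supnorm (f i :: 'a::{field,finite} fls ^ 'd) \<le> c" "0 \<le> c"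
  shows "supnorm (\<Sum>i\<in>A. f i) \<le> c"
  using assms by (auto simp: supnorm_le_iff intro!: absK_sum_le)

lemma mem_unit_body_iff: "x \<in> unit_body \<longleftrightarrow> supnorm (x :: 'a::{field,finite} fls ^ 'd) \<le> 1"
  by (simp add: unit_body_def supnorm_le_iff mem_ring_O_iff)

lemma supnorm_matrix_vector_mult_le:
  fixes A :: "'a::{field,finite} fls ^ 'd ^ 'd"
  assumes "\<And>i j. absK (A $ i $ j) \<le> c"
  shows "supnorm (A *v x) \<le> c * supnorm x"
proof -
  have "0 \<le> c" using assms absK_nonneg order_trans by blast
  thus ?thesis
    unfolding supnorm_le_iff matrix_vector_mult_def
    by (auto intro!: absK_sum_le mult_mono assms absK_nth_le_supnorm)
qed

text \<open>Hadamard's inequality for the maximum norm: every Leibniz term takes one entry from each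
  column, and an ultrametric sum is no larger than its largest term.\<close>

lemma absK_det_le:
  fixes A :: "'a::{field,finite} fls ^ 'd ^ 'd"
  assumes "\<And>i j. absK (A $ i $ j) \<le> c j" "\<And>j. 0 \<le> c j"
  shows "absK (fdet A) \<le> (\<Prod>j\<in>UNIV. c j)"
  unfolding Determinants.det_def
proof (rule absK_sum_le)
  fix p :: "'d \<Rightarrow> 'd" assume p: "p \<in> {p. p permutes UNIV}"
  have "absK (of_int (sign p) :: 'a fls) = 1" by (simp add: sign_def)
  hence "absK (of_int (sign p) * (\<Prod>i\<in>UNIV. A $ i $ p i)) = (\<Prod>i\<in>UNIV. absK (A $ i $ p i))"
    by (simp add: absK_prod)
  also have "\<dots> \<le> (\<Prod>i\<in>UNIV. c (p i))" by (intro prod_mono) (simp add: assms)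
  also have "\<dots> = (\<Prod>i\<in>UNIV. c i)"
    using p prod.permute[of p UNIV c] by (simp add: o_def)
  finally show "absK (of_int (sign p) * (\<Prod>i\<in>UNIV. A $ i $ p i)) \<le> (\<Prod>j\<in>UNIV. c j)" .
qed (auto intro: prod_nonneg assms)

text \<open>Cramer's rule turns the left side into the determinant with column k replaced by A x, to
  which Hadamard's bound applies. When |det A| is the full product of the column bounds, this
  becomes orthogonality of the columns.\<close>

lemma absK_coord_mult_det_le:
  fixes A :: "'a::{field,finite} fls ^ 'd ^ 'd"
  assumes "\<And>i j. absK (A $ i $ j) \<le> c j" "\<And>j. 0 \<le> c j"
  shows "absK (x $ k) * absK (fdet A) \<le> supnorm (A *v x) * (\<Prod>j\<in>UNIV-{k}. c j)"
proof -
  let ?B = "(\<chi> i j. if j = k then (A *v x) $ i else A $ i $ j) :: 'a fls ^ 'd ^ 'd"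
  have "absK (x $ k) * absK (fdet A) = absK (fdet ?B)"
    by (simp add: cramer_lemma)
  also have "\<dots> \<le> (\<Prod>j\<in>UNIV. if j = k then supnorm (A *v x) else c j)"
    by (rule absK_det_le) (auto simp: assms absK_nth_le_supnorm)
  also have "\<dots> = supnorm (A *v x) * (\<Prod>j\<in>UNIV-{k}. c j)"
    by (subst prod.remove[of _ k]) (auto intro!: prod.cong)
  finally show ?thesis .
qed

lemma matrix_inv_cancel:
  fixes A :: "'a::field ^ 'd ^ 'd"
  assumes "invertible A"
  shows "A ** matrix_inv A = Finite_Cartesian_Product.mat 1"
    "matrix_inv A ** A = Finite_Cartesian_Product.mat 1"
  using assms unfolding invertible_def matrix_inv_def by (metis (mono_tags, lifting) someI_ex)+

lemma matrix_inv_cancel_vec [simp]: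
  fixes A :: "'a::field ^ 'd ^ 'd"
  assumes "invertible A"
  shows "A *v (matrix_inv A *v x) = x" "matrix_inv A *v (A *v x) = x"
  using matrix_inv_cancel[OF assms] by (simp_all add: matrix_vector_mul_assoc)

lemma invertible_matrix_inv: "invertible A \<Longrightarrow> invertible (matrix_inv (A :: 'a::field ^ 'd ^ 'd))"
  unfolding invertible_def[of "matrix_inv A"] using matrix_inv_cancel by blast

lemma absK_det_matrix_inv:
  fixes A :: "'a::{field,finite} fls ^ 'd ^ 'd"
  assumes "invertible A"
  shows "absK (fdet (matrix_inv A)) = inverse (absK (fdet A))"
proof -
  have "fdet A * fdet (matrix_inv A) = 1"
    using matrix_inv_cancel[OF assms] by (simp flip: det_mul)
  hence "absK (fdet A) * absK (fdet (matrix_inv A)) = 1"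
    by (simp flip: absK_mult)
  thus ?thesis by (simp add: inverse_unique)
qed

lemma absK_entry_le_supnorm_isometry:
  fixes A :: "'a::{field,finite} fls ^ 'd ^ 'd"
  assumes "\<And>x. supnorm (A *v x) \<le> supnorm x"
  shows "absK (A $ i $ j) \<le> 1"
proof -
  have "absK (A $ i $ j) = absK ((A *v axis j 1) $ i)"
    by (simp add: matrix_vector_mult_def axis_def if_distrib cong: if_cong)
  also have "\<dots> \<le> supnorm (axis j 1 :: 'a fls ^ 'd)"
    using absK_nth_le_supnorm assms order_trans by blast
  also have "\<dots> \<le> 1" by (auto simp: supnorm_le_iff axis_def)
  finally show ?thesis .
qed

text \<open>The matrix and its inverse both have entries of absolute value at most 1, so both
  determinants do; their product is 1.\<close>

lemma isometry_absK_det: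
  fixes A :: "'a::{field,finite} fls ^ 'd ^ 'd"
  assumes "\<And>x. supnorm (A *v x) = supnorm x"
  shows "invertible A" "absK (fdet A) = 1"
proof -
  have "x = 0" if "A *v x = 0" for x
    using assms[of x] that by simp
  hence "\<exists>B. B ** A = Finite_Cartesian_Product.mat 1" unfolding matrix_left_invertible_ker by blast
  thus inv: "invertible A" by (simp add: invertible_left_inverse)
  have "absK (fdet A) \<le> (\<Prod>j\<in>(UNIV::'d set). 1)"
    by (intro absK_det_le absK_entry_le_supnorm_isometry) (auto simp: assms)
  moreover have "absK (fdet (matrix_inv A)) \<le> (\<Prod>j\<in>(UNIV::'d set). 1)"
  proof (intro absK_det_le absK_entry_le_supnorm_isometry)
    fix x show "supnorm (matrix_inv A *v x) \<le> supnorm x"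
      using assms[of "matrix_inv A *v x"] inv by simp
  qed auto
  moreover have "absK (fdet A) \<noteq> 0" using inv by (simp add: invertible_det_nz)
  ultimately show "absK (fdet A) = 1"
    using inv by (simp add: absK_det_matrix_inv field_simps)
qed

subsection \<open>Haar measure of convex bodies\<close>

text \<open>A form of openness that survives invertible matrices, translations and intersections by
  plain norm estimates. It certifies measurability of the boxes, the cells and their intersections
  without continuity arguments in the product topology.\<close>

definition uniformly_open :: "('a::{field,finite} fls ^ 'd) set \<Rightarrow> bool" where
  "uniformly_open S \<longleftrightarrow> (\<exists>\<epsilon>>0. \<forall>x\<in>S. \<forall>y. supnorm (y - x) < \<epsilon> \<longrightarrow> y \<in> S)"

text \<open>The library metric has base 2 instead of q. A distance below 2^(-n) forces an order
  above n, hence an absolute value of at most q^(-n).\<close>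

lemma ex_dist_fls_imp_absK_less:
  assumes "0 < \<epsilon>"
  shows "\<exists>r>0. \<forall>x y :: 'a::{field,finite} fls. dist y x < r \<longrightarrow> absK (y - x) < \<epsilon>"
proof -
  let ?q = "real CARD('a)"
  have q: "1 < ?q" using card_field_gt_1[where 'a='a] by simp
  then obtain n where n: "(inverse ?q) ^ n < \<epsilon>"
    using real_arch_pow_inv[OF assms, of "inverse ?q"] by (auto simp: field_simps)
  have "absK (y - x) < \<epsilon>" if d: "dist y x < inverse (2 ^ n)" for x y :: "'a fls"
  proof (cases "y = x")
    case False
    let ?s = "fls_subdegree (y - x)"
    have s: "0 \<le> ?s"
    proof (rule ccontr)
      assume "\<not> 0 \<le> ?s"
      hence "(2::real) ^ nat (- ?s) < inverse (2 ^ n)" using d False by (simp add: dist_fls_def)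
      moreover have "inverse (2 ^ n) \<le> (1::real)" by (simp add: inverse_le_1_iff)
      moreover have "(1::real) \<le> 2 ^ nat (- ?s)" by simp
      ultimately show False by linarith
    qed
    hence "inverse (2 ^ nat ?s) < (inverse (2 ^ n) :: real)" using d False by (simp add: dist_fls_def)
    hence "n < nat ?s" by (simp add: inverse_less_iff_less)
    hence "absK (y - x) \<le> absK ((fls_X :: 'a fls) ^ n)"
      by (subst absK_le_iff) auto
    thus ?thesis using n by simp
  qed (use assms in simp)
  thus ?thesis by (intro exI[of _ "inverse (2 ^ n)"]) auto
qed

lemma open_absK_ball:
  assumes "0 < \<epsilon>"
  shows "open {y :: 'a::{field,finite} fls. absK (y - c) < \<epsilon>}"
  unfolding open_fls_def
proof safe
  fix a assume a: "absK (a - c) < \<epsilon>"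
  obtain r where r: "r > 0" "\<And>x y :: 'a fls. dist y x < r \<Longrightarrow> absK (y - x) < \<epsilon>"
    using ex_dist_fls_imp_absK_less[OF assms] by blast
  have "absK (y - c) < \<epsilon>" if "dist y a < r" for y
    using absK_add_less[OF r(2)[OF that] a] by simp
  thus "\<exists>r>0. {y. dist y a < r} \<subseteq> {y. absK (y - c) < \<epsilon>}" using r(1) by blast
qed

lemma uniformly_open_imp_open:
  assumes "uniformly_open S"
  shows "open S"
  unfolding open_vec_def
proof
  fix x assume x: "x \<in> S"
  obtain \<epsilon> where e: "\<epsilon> > 0" "\<And>x y. x \<in> S \<Longrightarrow> supnorm (y - x) < \<epsilon> \<Longrightarrow> y \<in> S"
    using assms unfolding uniformly_open_def by blast
  show "\<exists>A. (\<forall>i. open (A i) \<and> x $ i \<in> A i) \<and> (\<forall>y. (\<forall>i. y $ i \<in> A i) \<longrightarrow> y \<in> S)"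
  proof (intro exI conjI allI impI)
    show "open {y. absK (y - x $ i) < \<epsilon>}" for i by (rule open_absK_ball[OF e(1)])
    show "x $ i \<in> {y. absK (y - x $ i) < \<epsilon>}" for i using e(1) by simp
    fix y assume "\<forall>i. y $ i \<in> {y. absK (y - x $ i) < \<epsilon>}"
    thus "y \<in> S" by (intro e(2)[OF x]) (auto simp: supnorm_less_iff)
  qed
qed

lemma uniformly_open_borel: "uniformly_open S \<Longrightarrow> S \<in> sets borel"
  by (intro borel_open uniformly_open_imp_open)

lemma ex_matrix_vector_mult_bound:
  fixes A :: "'a::{field,finite} fls ^ 'd ^ 'd"
  obtains c where "c > 0" "\<And>x. supnorm (A *v x) \<le> c * supnorm x"
proof
  \<comment> \<open>A crude bound by the sum of all entries; the 1 keeps it positive for the zero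
    matrix, so that it can be divided by.\<close>
  define c where "c = 1 + (\<Sum>i\<in>UNIV. \<Sum>j\<in>UNIV. absK (A $ i $ j))"
  have "absK (A $ i $ j) \<le> (\<Sum>j\<in>UNIV. absK (A $ i $ j))" for i j
    by (rule member_le_sum) auto
  also have "(\<Sum>j\<in>UNIV. absK (A $ i $ j)) \<le> c" for i
    unfolding c_def by (rule order_trans[OF member_le_sum[of i UNIV "\<lambda>i. \<Sum>j\<in>UNIV. absK (A $ i $ j)"]])
      (auto intro: sum_nonneg)
  finally show "supnorm (A *v x) \<le> c * supnorm x" for x
    by (rule supnorm_matrix_vector_mult_le)
  show "c > 0" unfolding c_def by (intro add_pos_nonneg sum_nonneg) auto
qed

lemma uniformly_open_image:
  fixes A :: "'a::{field,finite} fls ^ 'd ^ 'd"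
  assumes "invertible A" "uniformly_open S"
  shows "uniformly_open ((*v) A ` S)"
proof -
  obtain \<epsilon> where e: "\<epsilon> > 0" "\<And>x y. x \<in> S \<Longrightarrow> supnorm (y - x) < \<epsilon> \<Longrightarrow> y \<in> S"
    using assms unfolding uniformly_open_def by blast
  obtain c where "c > 0" and c: "\<And>x. supnorm (matrix_inv A *v x) \<le> c * supnorm x"
    using ex_matrix_vector_mult_bound[of "matrix_inv A"] by blast
  show ?thesis unfolding uniformly_open_def
  proof (intro exI conjI ballI allI impI)
    show "0 < \<epsilon> / c" using e \<open>c > 0\<close> by simp
    fix x y assume "x \<in> (*v) A ` S" and d: "supnorm (y - x) < \<epsilon> / c"
    then obtain z where z: "z \<in> S" "x = A *v z" by blast
    have "supnorm (matrix_inv A *v y - z) = supnorm (matrix_inv A *v (y - x))"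
      using z assms(1) by (simp add: matrix_vector_mult_diff_distrib)
    also have "\<dots> < \<epsilon>" using c[of "y - x"] d \<open>c > 0\<close> by (simp add: field_simps)
    finally have "matrix_inv A *v y \<in> S" by (rule e(2)[OF z(1)])
    moreover have "y = A *v (matrix_inv A *v y)" using assms(1) by simp
    ultimately show "y \<in> (*v) A ` S" by blast
  qed
qed

lemma uniformly_open_translate:
  assumes "uniformly_open S"
  shows "uniformly_open ((+) a ` S)"
proof -
  obtain \<epsilon> where e: "\<epsilon> > 0" "\<And>x y. x \<in> S \<Longrightarrow> supnorm (y - x) < \<epsilon> \<Longrightarrow> y \<in> S"
    using assms unfolding uniformly_open_def by blast
  have "y \<in> (+) a ` S" if "x \<in> S" "supnorm (y - (a + x)) < \<epsilon>" for x y
    using e(2)[OF that(1), of "y - a"] that(2) by (auto simp: image_iff algebra_simps intro!: bexI[of _ "y - a"])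
  thus ?thesis unfolding uniformly_open_def using e(1) by blast
qed

lemma uniformly_open_Int:
  assumes "uniformly_open S" "uniformly_open T"
  shows "uniformly_open (S \<inter> T)"
proof -
  obtain \<epsilon> where e: "\<epsilon> > 0" "\<And>x y. x \<in> S \<Longrightarrow> supnorm (y - x) < \<epsilon> \<Longrightarrow> y \<in> S"
    using assms unfolding uniformly_open_def by blast
  obtain \<delta> where d: "\<delta> > 0" "\<And>x y. x \<in> T \<Longrightarrow> supnorm (y - x) < \<delta> \<Longrightarrow> y \<in> T"
    using assms unfolding uniformly_open_def by blast
  show ?thesis unfolding uniformly_open_def
    by (intro exI[of _ "min \<epsilon> \<delta>"]) (use e d in auto)
qed

lemma uniformly_open_unit_body: "uniformly_open (unit_body :: ('a::{field,finite} fls ^ 'd) set)"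
  unfolding uniformly_open_def
proof (intro exI[of _ 1] conjI ballI allI impI)
  fix x y :: "'a fls ^ 'd" assume "x \<in> unit_body" "supnorm (y - x) < 1"
  thus "y \<in> unit_body" using supnorm_add_le_max[of x "y - x"] by (auto simp: mem_unit_body_iff)
qed simp

lemma uniformly_open_coord_less_1: "uniformly_open {x :: 'a::{field,finite} fls ^ 'd. absK (x $ k) < 1}"
  unfolding uniformly_open_def
proof (intro exI[of _ 1] conjI ballI allI impI)
  fix x y :: "'a fls ^ 'd" assume "x \<in> {x. absK (x $ k) < 1}" "supnorm (y - x) < 1"
  thus "y \<in> {x. absK (x $ k) < 1}"
    using absK_add_less[of "x $ k" 1 "(y - x) $ k"] by (auto simp: supnorm_less_iff)
qed simp

lemma supnorm_axis_const_le: "supnorm (axis k (fls_const t) :: 'a::{field,finite} fls ^ 'd) \<le> 1"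
  by (cases "t = 0") (auto simp: supnorm_le_iff axis_def)

section \<open>Column operations\<close>

definition replace_column :: "'a::field ^ 'd ^ 'd \<Rightarrow> 'd \<Rightarrow> 'a ^ 'd \<Rightarrow> 'a ^ 'd ^ 'd" where
  "replace_column A k w = (\<chi> i j. if j = k then w $ i else A $ i $ j)"

lemma det_replace_column: "fdet (replace_column A k (A *v c)) = c $ k * fdet A"
  unfolding replace_column_def by (rule cramer_lemma)

lemma column_replace_column:
  "column j (replace_column A k w) = (if j = k then w else column j A)"
  by (simp add: column_def replace_column_def)

text \<open>Replacing a column by A c amounts to applying A after an elementary substitution of the
  coordinates, so the effect on volumes can be studied on the unit body.\<close>

lemma replace_column_mult_vec:
  "replace_column A k (A *v c) *v y = A *v (\<chi> i. (if i = k then 0 else y $ i) + y $ k * c $ i)"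
proof -
  have "(if j = k then (A *v c) $ i else A $ i $ j) * y $ j =
      A $ i $ j * (if j = k then 0 else y $ j) + (if j = k then (A *v c) $ i * y $ k else 0)" for i j
    by simp
  hence "(replace_column A k (A *v c) *v y) $ i =
      (\<Sum>j\<in>UNIV. A $ i $ j * (if j = k then 0 else y $ j)) + (A *v c) $ i * y $ k" for i
    unfolding matrix_vector_mult_def[of "replace_column A k (A *v c)"]
    by (simp add: replace_column_def sum.distrib)
  also have "\<dots> i = (A *v (\<chi> i. (if i = k then 0 else y $ i) + y $ k * c $ i)) $ i" for i
    by (simp add: matrix_vector_mult_def sum.distrib distrib_left sum_distrib_left mult_ac)
  finally show ?thesis by (simp add: Finite_Cartesian_Product.vec_eq_iff)
qed

lemma invertible_replace_column:
  "invertible A \<Longrightarrow> c $ k \<noteq> 0 \<Longrightarrow> invertible (replace_column A k (A *v c))"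
  by (simp add: invertible_det_nz det_replace_column)

lemma mult_vec_axis: "(A *v axis k z) $ i = A $ i $ k * (z :: 'a::field)"
  by (simp add: matrix_vector_mult_def axis_def if_distrib cong: if_cong)

definition scale_column :: "'a::field ^ 'd ^ 'd \<Rightarrow> 'd \<Rightarrow> 'a \<Rightarrow> 'a ^ 'd ^ 'd" where
  "scale_column A k z = replace_column A k (A *v axis k z)"

lemma scale_column_nth:
  "scale_column A k z $ i $ j = (if j = k then A $ i $ j * z else A $ i $ j)"
  by (simp add: scale_column_def replace_column_def mult_vec_axis)

lemma scale_column_scale_column: "scale_column (scale_column A k z) k w = scale_column A k (z * w)"
  by (simp add: Finite_Cartesian_Product.vec_eq_iff scale_column_nth)

lemma scale_column_1 [simp]: "scale_column A k 1 = A"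
  by (simp add: Finite_Cartesian_Product.vec_eq_iff scale_column_nth)

lemma invertible_scale_column: "invertible A \<Longrightarrow> z \<noteq> 0 \<Longrightarrow> invertible (scale_column A k z)"
  unfolding scale_column_def by (rule invertible_replace_column) (simp_all add: axis_def)

text \<open>\<open>fls_nth f 0\<close> is the residue class of an integral \<open>f\<close> in the
  field with q elements.\<close>

lemma absK_diff_const_less_1:
  assumes "absK (f :: 'a::{field,finite} fls) \<le> 1"
  shows "absK (f - fls_const (fls_nth f 0)) < 1"
proof (cases "f - fls_const (fls_nth f 0) = 0")
  case False
  have "0 < fls_subdegree (f - fls_const (fls_nth f 0))"
    using assms absK_le_iff[of 1 f] False
    by (intro fls_subdegree_greaterI) (auto simp: le_less fls_const_def)
  thus ?thesis unfolding absK_less_1_iff by (subst absK_le_iff) auto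
qed simp

section \<open>Haar volume of images of the unit body\<close>

context
  fixes m :: "('a::{field,finite} fls ^ 'd) measure"
  assumes haar: "haar_measure m"
begin

definition body_volume :: "'a fls ^ 'd ^ 'd \<Rightarrow> ennreal" where
  "body_volume A = emeasure m ((*v) A ` unit_body)"

lemma haar_sets: "uniformly_open S \<Longrightarrow> S \<in> sets m"
  using haar uniformly_open_borel by (simp add: haar_measure_def)

lemma haar_translate: "uniformly_open S \<Longrightarrow> emeasure m ((+) a ` S) = emeasure m S"
  using haar uniformly_open_borel[of S] unfolding haar_measure_def by blast

text \<open>The substitution behind the new column maps \<open>unit_body\<close> onto itself, since
  \<open>c\<close> is integral with a unit at \<open>k\<close>; so even the two bodies
  coincide.\<close>

lemma body_volume_replace_column_unit:
  assumes "absK (c $ k) = 1" "\<And>i. absK (c $ i) \<le> 1"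
  shows "body_volume (replace_column A k (A *v c)) = body_volume A"
proof -
  let ?f = "\<lambda>y. (\<chi> i. (if i = k then 0 else y $ i) + y $ k * c $ i) :: 'a fls ^ 'd"
  have "?f ` unit_body = unit_body"
  proof (intro equalityI subsetI)
    fix x assume "x \<in> ?f ` unit_body"
    then obtain y where y: "x = ?f y" "\<And>i. absK (y $ i) \<le> 1"
      by (auto simp: mem_unit_body_iff supnorm_le_iff)
    have "absK ((if i = k then 0 else y $ i) + y $ k * c $ i) \<le> 1" for i
      by (rule order_trans[OF absK_add_le_max]) (use y assms in \<open>auto intro: mult_le_one\<close>)
    thus "x \<in> unit_body" by (simp add: mem_unit_body_iff supnorm_le_iff y)
  next
    fix x :: "'a fls ^ 'd" assume x: "x \<in> unit_body"
    \<comment> \<open>The inverse substitution: the k-th equation determines y_k, and the other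
      coordinates follow.\<close>
    define y :: "'a fls ^ 'd" where "y = (\<chi> i. if i = k then x $ k / c $ k else x $ i - x $ k / c $ k * c $ i)"
    have "absK (x $ i - x $ k / c $ k * c $ i) \<le> 1" for i
      by (rule order_trans[OF absK_diff_le_max])
        (use x assms in \<open>auto simp: mem_unit_body_iff supnorm_le_iff intro: mult_le_one\<close>)
    hence "y \<in> unit_body"
      using x assms by (auto simp: y_def mem_unit_body_iff supnorm_le_iff)
    moreover have "x = ?f y"
      using assms(1) by (auto simp: y_def Finite_Cartesian_Product.vec_eq_iff)
    ultimately show "x \<in> ?f ` unit_body" by blast
  qed
  moreover have "(*v) (replace_column A k (A *v c)) ` unit_body = (*v) A ` (?f ` unit_body)"
    by (auto simp: replace_column_mult_vec image_image)
  ultimately show ?thesis by (simp add: body_volume_def)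
qed

text \<open>The residue field has q elements: sorting the k-th coordinate by its constant term
  splits the body into q disjoint translates of the body whose column \<open>k\<close> is scaled by
  X.\<close>

lemma body_volume_eq_scale_column_X:
  assumes A: "invertible A"
  shows "body_volume A = ennreal (real CARD('a)) * body_volume (scale_column A k fls_X)"
proof -
  define H :: "('a fls ^ 'd) set" where "H = unit_body \<inter> {x. absK (x $ k) < 1}"
  have H: "uniformly_open ((*v) A ` H)"
    unfolding H_def
    by (intro uniformly_open_image uniformly_open_Int uniformly_open_unit_body
        uniformly_open_coord_less_1 A)
  have fH: "(\<chi> i. (if i = k then 0 else y $ i) + y $ k * axis k fls_X $ i) =
      (\<chi> i. if i = k then y $ k * fls_X else y $ i)" for y :: "'a fls ^ 'd"
    by (auto simp: Finite_Cartesian_Product.vec_eq_iff axis_def)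
  have "(*v) (scale_column A k fls_X) ` unit_body = (*v) A ` H"
  proof -
    have "(\<lambda>y. (\<chi> i. if i = k then y $ k * fls_X else y $ i)) ` unit_body = H"
    proof (intro equalityI subsetI)
      fix x :: "'a fls ^ 'd" assume "x \<in> (\<lambda>y. (\<chi> i. if i = k then y $ k * fls_X else y $ i)) ` unit_body"
      then obtain y :: "'a fls ^ 'd" where "y \<in> unit_body"
        and x: "x = (\<chi> i. if i = k then y $ k * fls_X else y $ i)" by (rule imageE)
      hence y: "absK (y $ i) \<le> 1" for i by (simp add: mem_unit_body_iff supnorm_le_iff)
      have "absK (y $ k) < real CARD('a)"
        using y[of k] card_field_gt_1[where 'a='a] by linarith
      hence "absK (x $ k) < 1" by (simp add: x field_simps)
      moreover have "absK (x $ i) \<le> 1" for i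
        using y[of i] calculation by (cases "i = k") (auto simp: x)
      ultimately show "x \<in> H" by (simp add: H_def mem_unit_body_iff supnorm_le_iff)
    next
      fix x :: "'a fls ^ 'd" assume x: "x \<in> H"
      hence "x $ k \<in> max_ideal" by (simp add: H_def mem_max_ideal_iff)
      then obtain f where f: "f \<in> ring_O" "x $ k = fls_X * f" by (auto simp: max_ideal_def)
      let ?y = "(\<chi> i. if i = k then f else x $ i) :: 'a fls ^ 'd"
      have "?y \<in> unit_body" using x f by (auto simp: H_def unit_body_def)
      moreover have "x = (\<chi> i. if i = k then ?y $ k * fls_X else ?y $ i)"
        using f by (auto simp: Finite_Cartesian_Product.vec_eq_iff mult.commute)
      ultimately show "x \<in> (\<lambda>y. (\<chi> i. if i = k then y $ k * fls_X else y $ i)) ` unit_body" by blast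
    qed
    hence "(*v) A ` H = (*v) A ` (\<lambda>y. (\<chi> i. if i = k then y $ k * fls_X else y $ i)) ` unit_body" by simp
    also have "\<dots> = (*v) (scale_column A k fls_X) ` unit_body"
      unfolding scale_column_def image_image replace_column_mult_vec fH ..
    finally show ?thesis ..
  qed
  hence vH: "body_volume (scale_column A k fls_X) = emeasure m ((*v) A ` H)"
    by (simp add: body_volume_def)
  \<comment> \<open>\<open>F t\<close> is the image of the part of the unit body whose k-th
    coordinate has constant term \<open>t\<close>.\<close>
  define F where "F = (\<lambda>t::'a. (+) (A *v axis k (fls_const t)) ` ((*v) A ` H))"
  have F: "F t = (\<lambda>y. A *v (axis k (fls_const t) + y)) ` H" for t
    by (simp add: F_def image_image matrix_vector_right_distrib)
  have "(*v) A ` unit_body = (\<Union>t. F t)"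
  proof (intro equalityI subsetI)
    fix x assume "x \<in> (*v) A ` unit_body"
    then obtain y where y: "x = A *v y" "y \<in> unit_body" by blast
    let ?e = "axis k (fls_const (fls_nth (y $ k) 0)) :: 'a fls ^ 'd"
    have "y - ?e \<in> unit_body"
      using y(2) supnorm_diff_le_max[of y ?e] supnorm_axis_const_le[of k "fls_nth (y $ k) 0"]
      unfolding mem_unit_body_iff by linarith
    moreover have "absK ((y - ?e) $ k) < 1"
      using absK_diff_const_less_1[of "y $ k"] y(2)
      by (simp add: axis_def mem_unit_body_iff supnorm_le_iff)
    ultimately have "y - ?e \<in> H" by (simp add: H_def)
    hence "x \<in> F (fls_nth (y $ k) 0)" unfolding F using y(1) by (intro image_eqI[of _ _ "y - ?e"]) auto
    thus "x \<in> (\<Union>t. F t)" by blast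
  next
    fix x assume "x \<in> (\<Union>t. F t)"
    then obtain t y where y: "y \<in> H" "x = A *v (axis k (fls_const t) + y)" by (auto simp: F)
    have "axis k (fls_const t) + y \<in> unit_body"
      using y(1) supnorm_add_le_max[of "axis k (fls_const t)" y] supnorm_axis_const_le[of k t]
      unfolding mem_unit_body_iff H_def Int_iff by linarith
    thus "x \<in> (*v) A ` unit_body" using y(2) by blast
  qed
  hence "body_volume A = emeasure m (\<Union>t. F t)" by (simp add: body_volume_def)
  also have "\<dots> = (\<Sum>t\<in>UNIV. emeasure m (F t))"
  proof (rule sum_emeasure[symmetric])
    show "range F \<subseteq> sets m"
      using H by (auto simp: F_def intro: haar_sets uniformly_open_translate)
    show "disjoint_family F"
      unfolding disjoint_family_on_def
    proof (intro ballI impI, rule ccontr)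
      fix s t :: 'a assume st: "s \<noteq> t" and "F s \<inter> F t \<noteq> {}"
      then obtain x y where xy: "x \<in> H" "y \<in> H"
        "A *v (axis k (fls_const s) + x) = A *v (axis k (fls_const t) + y)" by (auto simp: F)
      hence "axis k (fls_const s) + x = axis k (fls_const t) + y"
        by (metis A matrix_inv_cancel_vec(2))
      hence "(axis k (fls_const s) + x) $ k = (axis k (fls_const t) + y) $ k" by simp
      hence "fls_const (s - t) = y $ k - x $ k"
        by (simp add: axis_def fls_minus_const[symmetric] algebra_simps)
      moreover have "absK (y $ k - x $ k) < 1"
        using absK_add_less[of "y $ k" 1 "- (x $ k)"] xy by (simp add: H_def)
      ultimately show False using st absK_fls_const[of "s - t"] by simp
    qed
  qed simp
  also have "\<dots> = ennreal (real CARD('a)) * emeasure m ((*v) A ` H)"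
    unfolding F_def by (simp add: haar_translate[OF H] ennreal_of_nat_eq_real_of_nat)
  finally show ?thesis by (simp add: vH)
qed

text \<open>The factors obeying the rule are closed under products, and \<open>z\<close> is a unit
  times a power of X; so units, X and 1/X suffice. \<open>P\<close> quantifies over all matrices
  because the second factor acts on an already scaled one.\<close>

lemma body_volume_scale_column:
  assumes "invertible A" "z \<noteq> 0"
  shows "body_volume (scale_column A k z) = ennreal (absK z) * body_volume A"
proof -
  define P where "P = (\<lambda>z. z \<noteq> 0 \<and> (\<forall>A. invertible A \<longrightarrow>
    body_volume (scale_column A k z) = ennreal (absK z) * body_volume A))"
  have mult: "P (z * w)" if "P z" "P w" for z w
    unfolding P_def
  proof (intro conjI allI impI)
    fix A :: "'a fls ^ 'd ^ 'd" assume "invertible A"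
    hence "body_volume (scale_column (scale_column A k z) k w)
        = ennreal (absK w) * (ennreal (absK z) * body_volume A)"
      using that invertible_scale_column[of A z k] by (simp add: P_def)
    thus "body_volume (scale_column A k (z * w)) = ennreal (absK (z * w)) * body_volume A"
      by (simp add: scale_column_scale_column ennreal_mult mult_ac)
  qed (use that in \<open>auto simp: P_def\<close>)
  have unit: "P u" if "absK u = 1" for u
    unfolding P_def
  proof (intro conjI allI impI)
    show "u \<noteq> 0" using that by auto
    fix A
    have "body_volume (scale_column A k u) = body_volume A"
      unfolding scale_column_def
      by (rule body_volume_replace_column_unit) (auto simp: axis_def that)
    thus "body_volume (scale_column A k u) = ennreal (absK u) * body_volume A" by (simp add: that)
  qed
  have Xinv: "P (inverse fls_X)"
    unfolding P_def
  proof (intro conjI allI impI)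
    fix A :: "'a fls ^ 'd ^ 'd" assume "invertible A"
    hence "invertible (scale_column A k (inverse fls_X))" by (intro invertible_scale_column) auto
    from body_volume_eq_scale_column_X[OF this, of k]
    show "body_volume (scale_column A k (inverse fls_X)) = ennreal (absK (inverse fls_X :: 'a fls)) * body_volume A"
      by (simp add: scale_column_scale_column fls_inverse_X fls_X_inv_times_conv_shift)
  qed simp
  have X: "P fls_X"
    unfolding P_def
  proof (intro conjI allI impI)
    fix A :: "'a fls ^ 'd ^ 'd" assume "invertible A"
    have "ennreal (inverse (real CARD('a))) * body_volume A =
        (ennreal (inverse (real CARD('a))) * ennreal (real CARD('a))) * body_volume (scale_column A k fls_X)"
      unfolding body_volume_eq_scale_column_X[OF \<open>invertible A\<close>, of k] by (simp add: mult_ac)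
    also have "ennreal (inverse (real CARD('a))) * ennreal (real CARD('a)) = 1"
      by (simp flip: ennreal_mult)
    finally show "body_volume (scale_column A k fls_X) = ennreal (absK (fls_X :: 'a fls)) * body_volume A"
      by simp
  qed simp
  have pow: "P (w ^ n)" if "P w" for w n
    by (induction n) (auto intro: mult that unit)
  have powi: "P (fls_X powi n)" for n
    by (cases n rule: int_cases2) (auto simp: power_int_minus simp flip: power_inverse intro: pow X Xinv)
  obtain n where n: "absK z = absK (fls_X powi n :: 'a fls)"
    using ex_absK_eq_fls_X_powi[OF assms(2)] .
  have nz: "(fls_X powi n :: 'a fls) \<noteq> 0" by simp
  have "P (z / fls_X powi n * fls_X powi n)"
    by (intro mult unit powi) (use n nz in simp)
  hence "P z" using nz by simp
  thus ?thesis using assms by (simp add: P_def)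
qed

text \<open>Dividing \<open>c\<close> by its largest coordinate makes it integral. Its k-th
  coordinate is then moved into a scaling of column \<open>k\<close>; what remains has a 1 at
  \<open>k\<close> and is the unit case. Scaling by \<open>inverse z\<close> undoes the
  division.\<close>

lemma body_volume_replace_column:
  assumes A: "invertible A" and ck: "c $ k \<noteq> 0"
  shows "body_volume (replace_column A k (A *v c)) = ennreal (absK (c $ k)) * body_volume A"
proof -
  obtain i0 where i0: "supnorm c = absK (c $ i0)" by (rule ex_absK_nth_eq_supnorm)
  define z where "z = inverse (c $ i0)"
  have c0: "c $ i0 \<noteq> 0" using i0 ck absK_nth_le_supnorm[of c k] by auto
  hence z0: "z \<noteq> 0" by (simp add: z_def)
  have zc: "absK (z * c $ i) \<le> 1" for i
    using absK_nth_le_supnorm[of c i] i0 c0 by (simp add: z_def field_simps)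
  define B where "B = scale_column A k (z * c $ k)"
  define c' :: "'a fls ^ 'd" where "c' = (\<chi> i. if i = k then 1 else z * c $ i)"
  have B: "invertible B" unfolding B_def using A z0 ck by (intro invertible_scale_column) auto
  have "B *v c' = A *v (z *s c)"
    unfolding B_def scale_column_def replace_column_mult_vec
    by (rule arg_cong[of _ _ "(*v) A"]) (auto simp: Finite_Cartesian_Product.vec_eq_iff c'_def axis_def)
  hence eq: "replace_column A k (A *v c) = scale_column (replace_column B k (B *v c')) k (inverse z)"
    using z0 by (auto simp: Finite_Cartesian_Product.vec_eq_iff replace_column_def scale_column_nth B_def vector_scalar_commute)
  have "body_volume (replace_column A k (A *v c)) =
      ennreal (absK (inverse z)) * body_volume (replace_column B k (B *v c'))"
    unfolding eq by (intro body_volume_scale_column invertible_replace_column B) (use z0 in \<open>auto simp: c'_def\<close>)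
  also have "body_volume (replace_column B k (B *v c')) = body_volume B"
    by (rule body_volume_replace_column_unit) (use zc in \<open>auto simp: c'_def\<close>)
  also have "\<dots> = ennreal (absK (z * c $ k)) * body_volume A"
    unfolding B_def by (rule body_volume_scale_column) (use A z0 ck in auto)
  also have "ennreal (absK (inverse z)) * (ennreal (absK (z * c $ k)) * body_volume A)
      = ennreal (absK (inverse z) * absK (z * c $ k)) * body_volume A"
    by (simp add: ennreal_mult mult.assoc)
  also have "absK (inverse z) * absK (z * c $ k) = absK (c $ k)" using z0 by simp
  finally show ?thesis .
qed

text \<open>Columns are exchanged for standard basis vectors one at a time.\<close>

lemma body_volume_eq_absK_det:
  assumes "invertible M"
  shows "body_volume M = ennreal (absK (fdet M))"
  using assms
proof (induction "card {j. column j M \<noteq> axis j 1}" arbitrary: M rule: less_induct)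
  case less
  let ?bad = "\<lambda>M :: 'a fls ^ 'd ^ 'd. {j. column j M \<noteq> axis j 1}"
  show ?case
  proof (cases "?bad M = {}")
    case True
    hence "M $ i $ j = axis j 1 $ i" for i j by (auto simp: column_def Finite_Cartesian_Product.vec_eq_iff)
    hence "M = Finite_Cartesian_Product.mat 1"
      by (auto simp: Finite_Cartesian_Product.vec_eq_iff axis_def Finite_Cartesian_Product.mat_def)
    thus ?thesis using haar by (simp add: body_volume_def haar_measure_def)
  next
    case False
    then obtain j where j: "j \<in> ?bad M" by blast
    define c where "c = matrix_inv M *v axis j 1"
    have Mc: "M *v c = axis j 1" using less.prems by (simp add: c_def)
    \<comment> \<open>Column j can be exchanged for the standard vector only if that vector has a
      nonzero coefficient at j. If it has not, M is first changed, keeping volume and determinant,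
      into a matrix for which it has.\<close>
    have "\<exists>A c'. invertible A \<and> body_volume A = body_volume M \<and> absK (fdet A) = absK (fdet M) \<and>
        ?bad A \<subseteq> ?bad M \<and> A *v c' = axis j 1 \<and> c' $ j \<noteq> 0"
    proof (cases "c $ j = 0")
      case False
      thus ?thesis using Mc less.prems by blast
    next
      case True
      \<comment> \<open>If c vanished at all nonstandard columns, M c would combine standard columns
        only, and its j-th entry would be c_j = 0 instead of 1.\<close>
      have "\<exists>i\<in>?bad M. c $ i \<noteq> 0"
      proof (rule ccontr)
        assume neg: "\<not> ?thesis"
        have col: "M $ l $ i * c $ i = axis i 1 $ l * c $ i" for l i
          using neg by (cases "i \<in> ?bad M") (auto simp: column_def Finite_Cartesian_Product.vec_eq_iff)
        have "(M *v c) $ j = (\<Sum>i\<in>UNIV. axis i 1 $ j * c $ i)"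
          unfolding matrix_vector_mult_def by (simp add: col)
        also have "\<dots> = c $ j"
          by (simp add: axis_def if_distrib[of "\<lambda>x. x * _"] cong: if_cong)
        finally show False using True by (simp add: Mc)
      qed
      then obtain i where i: "i \<in> ?bad M" "c $ i \<noteq> 0" by blast
      hence ij: "i \<noteq> j" using True by auto
      \<comment> \<open>Column j is added to column i. To represent the same vector, c_i copies of
        column j are taken back, so the coefficient at j becomes -c_i, which is nonzero.\<close>
      define e where "e = (axis i 1 + axis j 1 :: 'a fls ^ 'd)"
      have ei: "e $ i = 1" using ij by (simp add: e_def axis_def)
      let ?A = "replace_column M i (M *v e)"
      let ?c = "c - axis j (c $ i)"
      have "invertible ?A" using less.prems ei by (intro invertible_replace_column) auto
      moreover have "body_volume ?A = body_volume M"
        using body_volume_replace_column[of M e i] less.prems ei by simp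
      moreover have "fdet ?A = fdet M" by (simp add: det_replace_column ei)
      moreover have "?bad ?A \<subseteq> ?bad M" using i(1) by (auto simp: column_replace_column)
      moreover have "?A *v ?c = axis j 1"
      proof -
        have "(\<chi> l. (if l = i then 0 else ?c $ l) + ?c $ i * e $ l) = c"
          using ij by (auto simp: Finite_Cartesian_Product.vec_eq_iff e_def axis_def)
        thus ?thesis by (simp only: replace_column_mult_vec Mc)
      qed
      moreover have "?c $ j \<noteq> 0" using True i by (simp add: axis_def)
      ultimately show ?thesis
        by (intro exI[of _ ?A] exI[of _ ?c] conjI) simp_all
    qed
    then obtain A c' where A: "invertible A" "body_volume A = body_volume M"
      "absK (fdet A) = absK (fdet M)" "?bad A \<subseteq> ?bad M" "A *v c' = axis j 1" "c' $ j \<noteq> 0"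
      by blast
    let ?B = "replace_column A j (A *v c')"
    have "?bad ?B \<subseteq> ?bad M - {j}" using A(4,5) by (auto simp: column_replace_column)
    hence "card (?bad ?B) < card (?bad M)" using j by (intro psubset_card_mono) auto
    hence "body_volume ?B = ennreal (absK (fdet ?B))"
      using A by (intro less.hyps invertible_replace_column) auto
    moreover have "body_volume ?B = ennreal (absK (c' $ j)) * body_volume M"
      unfolding body_volume_replace_column[of A c' j, OF A(1,6)] A(2) ..
    moreover have "absK (fdet ?B) = absK (c' $ j) * absK (fdet M)"
      unfolding det_replace_column by (simp add: A(3))
    \<comment> \<open>The volume of \<open>?B\<close> is known both by induction and by the column
      rule; the nonzero factor |c'_j| cancels.\<close>
    ultimately have "ennreal (absK (c' $ j)) * body_volume M = ennreal (absK (c' $ j)) * ennreal (absK (fdet M))"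
      by (simp add: ennreal_mult)
    thus ?thesis using A(6) by (simp add: ennreal_mult_cancel_left)
  qed
qed

lemma emeasure_convex_body:
  "invertible h \<Longrightarrow> emeasure m (convex_body h) = ennreal (absK (fdet h))"
  using body_volume_eq_absK_det by (simp add: body_volume_def convex_body_def)

lemma measure_convex_body:
  "invertible h \<Longrightarrow> measure m (convex_body h) = absK (fdet h)"
  by (simp add: measure_def emeasure_convex_body)

lemma open_unit_ball_eq: "{x :: 'a fls ^ 'd. supnorm x < 1} = (*s) fls_X ` unit_body"
proof (intro equalityI subsetI)
  fix x :: "'a fls ^ 'd" assume "x \<in> {x. supnorm x < 1}"
  hence "\<forall>i. \<exists>f\<in>ring_O. x $ i = fls_X * f"
    by (simp add: supnorm_less_iff flip: mem_max_ideal_iff) (auto simp: max_ideal_def)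
  then obtain f where f: "\<And>i. f i \<in> ring_O" "\<And>i. x $ i = fls_X * f i" by metis
  thus "x \<in> (*s) fls_X ` unit_body"
    by (intro image_eqI[of _ _ "\<chi> i. f i"]) (auto simp: unit_body_def Finite_Cartesian_Product.vec_eq_iff)
next
  fix x :: "'a fls ^ 'd" assume "x \<in> (*s) fls_X ` unit_body"
  thus "x \<in> {x. supnorm x < 1}"
    using card_field_gt_1[where 'a='a] by (auto simp: mem_unit_body_iff field_simps)
qed

text \<open>By discreteness the open unit ball is X times the unit body, whence the factor q^(-d).
  It is the same for all matrices and cancels when a box is compared with a fundamental
  cell.\<close>

lemma emeasure_image_open_unit_ball:
  assumes A: "invertible A"
  shows "emeasure m ((*v) A ` {x. supnorm x < 1}) =
    ennreal (absK (fdet A) / real CARD('a) ^ CARD('d))"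
proof -
  let ?B = "(\<chi> i. fls_X *s (A $ i)) :: 'a fls ^ 'd ^ 'd"
  have det: "fdet ?B = fls_X ^ CARD('d) * fdet A"
    by (simp add: Determinants.det_rows_mul)
  have "(*v) A ` {x. supnorm x < 1} = (*v) ?B ` unit_body"
    unfolding open_unit_ball_eq image_image
    by (auto simp: matrix_vector_mult_def Finite_Cartesian_Product.vec_eq_iff sum_distrib_left mult_ac intro!: image_cong)
  moreover have "invertible ?B" using A by (simp add: invertible_det_nz det)
  ultimately have "emeasure m ((*v) A ` {x. supnorm x < 1}) = ennreal (absK (fdet ?B))"
    using body_volume_eq_absK_det[of ?B] by (simp add: body_volume_def)
  thus ?thesis by (simp add: det divide_inverse mult.commute power_inverse)
qed

end

subsection \<open>Successive minima and orthonormal flags\<close>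

definition unit_min :: "('a::{field,finite} fls ^ 'd) set \<Rightarrow> nat \<Rightarrow> real" where
  "unit_min S i = (LEAST r. r > 0 \<and> vec.dim (vec.span (S \<inter> {v. supnorm v \<le> r})) \<ge> i)"

lemma succ_min_eq_unit_min:
  fixes h :: "'a::{field,finite} fls ^ 'd ^ 'd"
  assumes "invertible h"
  shows "succ_min h S i = unit_min ((*v) (matrix_inv h) ` S) i"
proof -
  have "vec.dim (vec.span (S \<inter> {v. body_norm h v \<le> r})) =
      vec.dim (vec.span ((*v) (matrix_inv h) ` S \<inter> {v. supnorm v \<le> r}))" for r
  proof -
    have "(*v) (matrix_inv h) ` S \<inter> {v. supnorm v \<le> r} =
        (*v) (matrix_inv h) ` (S \<inter> {v. body_norm h v \<le> r})"
      by (auto simp: body_norm_def)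
    moreover have "inj ((*v) (matrix_inv h))"
      by (metis assms inj_on_inverseI matrix_inv_cancel_vec(1))
    ultimately show ?thesis
      by (simp add: vec.dim_image_eq inj_on_subset)
  qed
  thus ?thesis by (simp add: succ_min_def unit_min_def)
qed

text \<open>Minimal vectors in flag form. Beyond the bare minima this says that every element of
  \<open>S\<close> shorter than s_k lies in the span of the earlier vectors, which is what the
  packing argument uses.\<close>

definition greedy :: "('a::{field,finite} fls ^ 'd) set \<Rightarrow> (nat \<Rightarrow> 'a fls ^ 'd) \<Rightarrow> bool" where
  "greedy S s \<longleftrightarrow> (\<forall>i\<in>{1..CARD('d)}. s i \<in> S \<and> s i \<notin> vec.span (s ` {1..<i}) \<and>
     (\<forall>x\<in>S. x \<notin> vec.span (s ` {1..<i}) \<longrightarrow> supnorm (s i) \<le> supnorm x))"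

definition locally_finite :: "('a::{field,finite} fls ^ 'd) set \<Rightarrow> bool" where
  "locally_finite S \<longleftrightarrow> (\<forall>r. finite (S \<inter> {x. supnorm x \<le> r}))"

lemma locally_finite_subset: "locally_finite T \<Longrightarrow> S \<subseteq> T \<Longrightarrow> locally_finite S"
  unfolding locally_finite_def by (meson Int_mono finite_subset order_refl)

lemma ex_greedy:
  fixes S :: "('a::{field,finite} fls ^ 'd) set"
  assumes fin: "locally_finite S" and span: "vec.span S = UNIV"
  shows "\<exists>s. greedy S s"
proof -
  have "\<exists>s. \<forall>i\<in>{1..n}. s i \<in> S \<and> s i \<notin> vec.span (s ` {1..<i}) \<and>
     (\<forall>x\<in>S. x \<notin> vec.span (s ` {1..<i}) \<longrightarrow> supnorm (s i) \<le> supnorm x)"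
    if "n \<le> CARD('d)" for n
    using that
  proof (induction n)
    case (Suc n)
    then obtain s where s: "\<forall>i\<in>{1..n}. s i \<in> S \<and> s i \<notin> vec.span (s ` {1..<i}) \<and>
     (\<forall>x\<in>S. x \<notin> vec.span (s ` {1..<i}) \<longrightarrow> supnorm (s i) \<le> supnorm x)" by auto
    define V where "V = vec.span (s ` {1..n})"
    have "vec.dim V \<le> card (s ` {1..n})"
      unfolding V_def by (rule vec.dim_le_card) auto
    also have "\<dots> \<le> n" using card_image_le[of "{1..n}" s] by simp
    finally have "vec.dim V < CARD('d)" using Suc.prems by simp
    hence "V \<noteq> UNIV" by (metis less_irrefl vec_dim_card)
    moreover have "S \<subseteq> V \<Longrightarrow> vec.span S \<subseteq> V" unfolding V_def by (intro vec.span_minimal) auto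
    ultimately obtain x0 where x0: "x0 \<in> S" "x0 \<notin> V" using span by auto
    \<comment> \<open>Local finiteness yields a minimum only within a ball, so the choice is
      restricted to vectors no longer than \<open>x0\<close>; longer ones cannot win.\<close>
    define F where "F = (S \<inter> {x. supnorm x \<le> supnorm x0}) - V"
    have "finite F" "x0 \<in> F" using fin x0 by (auto simp: F_def locally_finite_def)
    then obtain x where x: "x \<in> F" "\<forall>y\<in>F. supnorm x \<le> supnorm y"
      by (metis arg_min_if_finite(1) arg_min_least emptyE)
    have "supnorm x \<le> supnorm x0" using x \<open>x0 \<in> F\<close> by blast
    hence min: "supnorm x \<le> supnorm y" if "y \<in> S" "y \<notin> V" for y
      using x that by (cases "supnorm y \<le> supnorm x0") (auto simp: F_def)
    define t where "t = s(Suc n := x)"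
    have img: "t ` {1..<i} = s ` {1..<i}" if "i \<le> Suc n" for i
      using that by (auto simp: t_def)
    show ?case
    proof (intro exI[of _ t] ballI)
      fix i assume i: "i \<in> {1..Suc n}"
      show "t i \<in> S \<and> t i \<notin> vec.span (t ` {1..<i}) \<and>
        (\<forall>y\<in>S. y \<notin> vec.span (t ` {1..<i}) \<longrightarrow> supnorm (t i) \<le> supnorm y)"
      proof (cases "i = Suc n")
        case True
        hence "vec.span (t ` {1..<i}) = V" using img[of i] by (simp add: V_def atLeastLessThanSuc_atLeastAtMost)
        thus ?thesis using x(1) min by (auto simp: True t_def F_def)
      next
        case False
        hence "t i = s i" "i \<in> {1..n}" using i by (auto simp: t_def)
        thus ?thesis using s img[of i] by simp
      qed
    qed
  qed simp
  thus ?thesis unfolding greedy_def by blast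
qed

lemma independent_if_not_in_span_prefix:
  fixes s :: "nat \<Rightarrow> 'a::field ^ 'd"
  assumes "\<And>i. i \<in> {1..n} \<Longrightarrow> s i \<notin> vec.span (s ` {1..<i})"
  shows "vec.independent (s ` {1..n}) \<and> inj_on s {1..n}"
  using assms
proof (induction n)
  case (Suc n)
  have "s (Suc n) \<notin> vec.span (s ` {1..n})"
    using Suc.prems[of "Suc n"] by (simp add: atLeastLessThanSuc_atLeastAtMost)
  moreover from this have "s (Suc n) \<notin> s ` {1..n}" using vec.span_base[of "s (Suc n)" "s ` {1..n}"] by argo
  moreover have "vec.independent (s ` {1..n}) \<and> inj_on s {1..n}"
    by (rule Suc.IH, rule Suc.prems) simp
  moreover have "{1..Suc n} = insert (Suc n) {1..n}" by auto
  ultimately show ?case by (simp add: vec.independent_insert)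
qed (simp add: vec.independent_empty)

lemma greedy_independent:
  fixes s :: "nat \<Rightarrow> 'a::{field,finite} fls ^ 'd"
  assumes "greedy S s" "n \<le> CARD('d)"
  shows "vec.independent (s ` {1..n})" "inj_on s {1..n}"
  using independent_if_not_in_span_prefix[of n s] assms by (auto simp: greedy_def)

lemma greedy_mono:
  fixes s :: "nat \<Rightarrow> 'a::{field,finite} fls ^ 'd"
  assumes "greedy S s" "1 \<le> i" "i \<le> j" "j \<le> CARD('d)"
  shows "supnorm (s i) \<le> supnorm (s j)"
proof -
  have "vec.span (s ` {1..<i}) \<subseteq> vec.span (s ` {1..<j})"
    using assms by (intro vec.span_mono image_mono) auto
  thus ?thesis using assms unfolding greedy_def by (meson atLeastAtMost_iff order_trans subsetD)
qed

text \<open>s_1, ..., s_i are i independent elements of norm at most that of s_i. Conversely, a ball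
  of smaller radius meets \<open>S\<close> only within the span of i - 1 vectors.\<close>

lemma unit_min_greedy:
  fixes s :: "nat \<Rightarrow> 'a::{field,finite} fls ^ 'd"
  assumes s: "greedy S s" and i: "i \<in> {1..CARD('d)}"
  shows "unit_min S i = supnorm (s i)"
  unfolding unit_min_def
proof (rule Least_equality)
  have si: "s i \<notin> vec.span (s ` {1..<i})" using s i unfolding greedy_def by blast
  have "s i \<noteq> 0" using si vec.span_zero by metis
  moreover have "card (s ` {1..i}) \<le> vec.dim (S \<inter> {v. supnorm v \<le> supnorm (s i)})"
  proof (rule vec.independent_card_le_dim)
    show "s ` {1..i} \<subseteq> S \<inter> {v. supnorm v \<le> supnorm (s i)}"
      using s i greedy_mono[OF s] by (auto simp: greedy_def)
  qed (use greedy_independent[OF s] i in auto)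
  ultimately show "supnorm (s i) > 0 \<and> i \<le> vec.dim (vec.span (S \<inter> {v. supnorm v \<le> supnorm (s i)}))"
    using greedy_independent(2)[OF s, of i] i by (simp add: card_image vec.dim_span)
next
  fix r assume r: "r > 0 \<and> i \<le> vec.dim (vec.span (S \<inter> {v. supnorm v \<le> r}))"
  show "supnorm (s i) \<le> r"
  proof (rule ccontr)
    assume "\<not> supnorm (s i) \<le> r"
    hence "S \<inter> {v. supnorm v \<le> r} \<subseteq> vec.span (s ` {1..<i})"
      using s i by (fastforce simp: greedy_def)
    hence "vec.dim (S \<inter> {v. supnorm v \<le> r}) \<le> card (s ` {1..<i})"
      by (rule vec.dim_le_card) auto
    also have "\<dots> \<le> i - 1" using card_image_le[of "{1..<i}" s] by simp
    finally have "vec.dim (S \<inter> {v. supnorm v \<le> r}) < i" using i by auto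
    thus False using r by (simp add: vec.dim_span)
  qed
qed

text \<open>
  Gaussian elimination with the largest entry as pivot: \<open>\<pi> i\<close> is the pivot row of \<open>u i\<close>, where
  all later vectors vanish.
\<close>

lemma ex_pivoted_flag:
  fixes s :: "nat \<Rightarrow> 'a::{field,finite} fls ^ 'd"
  assumes "\<And>i. i \<in> {1..n} \<Longrightarrow> s i \<notin> vec.span (s ` {1..<i})"
  shows "\<exists>u \<pi>. (\<forall>k\<le>n. vec.span (u ` {1..k}) = vec.span (s ` {1..k})) \<and>
    (\<forall>i\<in>{1..n}. supnorm (u i) \<le> 1 \<and> u i $ \<pi> i = 1 \<and> (\<forall>j\<in>{1..<i}. u i $ \<pi> j = 0))"
  using assms
proof (induction n)
  case (Suc n)
  then obtain u \<pi> where span: "\<And>k. k \<le> n \<Longrightarrow> vec.span (u ` {1..k}) = vec.span (s ` {1..k})"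
    and u: "\<And>i. i \<in> {1..n} \<Longrightarrow> supnorm (u i) \<le> 1" "\<And>i. i \<in> {1..n} \<Longrightarrow> u i $ \<pi> i = 1"
      "\<And>i j. i \<in> {1..n} \<Longrightarrow> j \<in> {1..<i} \<Longrightarrow> u i $ \<pi> j = 0"
    by (metis (no_types, lifting) atLeastAtMost_iff le_Suc_eq)
  let ?x = "s (Suc n)"
  \<comment> \<open>The pivot rows are cleared in increasing order: each u vanishes in the earlier
    pivot rows, so clearing the next row leaves those at zero.\<close>
  have "\<exists>w\<in>vec.span (u ` {1..k}). \<forall>j\<in>{1..k}. (?x - w) $ \<pi> j = 0" if "k \<le> n" for k
    using that
  proof (induction k)
    case 0
    show ?case by (intro bexI[of _ 0]) (auto simp: vec.span_zero)
  next
    case (Suc k)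
    then obtain w where w: "w \<in> vec.span (u ` {1..k})" "\<And>j. j \<in> {1..k} \<Longrightarrow> (?x - w) $ \<pi> j = 0" by auto
    let ?w = "w + (?x - w) $ \<pi> (Suc k) *s u (Suc k)"
    have "?w \<in> vec.span (u ` {1..Suc k})"
      by (intro vec.span_add vec.span_scale vec.span_base subsetD[OF vec.span_mono w(1)]) auto
    moreover have "(?x - ?w) $ \<pi> j = 0" if "j \<in> {1..Suc k}" for j
    proof (cases "j = Suc k")
      case True
      thus ?thesis using u(2)[of "Suc k"] Suc.prems by simp
    next
      case False
      hence "j \<in> {1..k}" using that by auto
      thus ?thesis using w(2)[of j] u(3)[of "Suc k" j] Suc.prems by (simp add: algebra_simps)
    qed
    ultimately show ?case by blast
  qed
  from this[of n] obtain w where w: "w \<in> vec.span (u ` {1..n})" "\<And>j. j \<in> {1..n} \<Longrightarrow> (?x - w) $ \<pi> j = 0"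
    by auto
  define y where "y = ?x - w"
  obtain p where p: "supnorm y = absK (y $ p)" by (rule ex_absK_nth_eq_supnorm)
  have "?x \<notin> vec.span (u ` {1..n})"
    using Suc.prems[of "Suc n"] span[of n] by (simp add: atLeastLessThanSuc_atLeastAtMost)
  hence "y \<noteq> 0" using w(1) by (auto simp: y_def)
  hence yp: "y $ p \<noteq> 0" using p by auto
  \<comment> \<open>\<open>p\<close> is a largest coordinate of \<open>y\<close>; dividing by it
    gives norm 1 and pivot entry 1 at once.\<close>
  define u' where "u' = u(Suc n := inverse (y $ p) *s y)"
  define \<pi>' where "\<pi>' = \<pi>(Suc n := p)"
  have "vec.span (u' ` {1..k}) = vec.span (s ` {1..k})" if "k \<le> Suc n" for k
  proof (cases "k = Suc n")
    case False
    hence "u' ` {1..k} = u ` {1..k}" using that by (auto simp: u'_def)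
    thus ?thesis using span[of k] False that by simp
  next
    case True
    have "u' ` {1..Suc n} = insert (inverse (y $ p) *s y) (u ` {1..n})"
      by (auto simp: u'_def atLeastAtMostSuc_conv)
    moreover have "s ` {1..Suc n} = insert ?x (s ` {1..n})"
      by (auto simp: atLeastAtMostSuc_conv)
    moreover have "vec.span (insert (inverse (y $ p) *s y) (u ` {1..n})) = vec.span (insert ?x (s ` {1..n}))"
    proof -
      have sub: "u ` {1..n} \<subseteq> vec.span (insert ?x (s ` {1..n}))"
        by (meson order_trans span[OF order_refl, THEN equalityD1] vec.span_mono subset_insertI vec.span_superset)
      have sub': "s ` {1..n} \<subseteq> vec.span (insert (inverse (y $ p) *s y) (u ` {1..n}))"
        by (meson order_trans span[OF order_refl, THEN equalityD2] vec.span_mono subset_insertI vec.span_superset)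
      have w1: "w \<in> vec.span (insert ?x (s ` {1..n}))"
        using w(1) span[of n] vec.span_mono[of "s ` {1..n}" "insert ?x (s ` {1..n})"] by auto
      have w2: "w \<in> vec.span (insert (inverse (y $ p) *s y) (u ` {1..n}))"
        using w(1) vec.span_mono[of "u ` {1..n}" "insert (inverse (y $ p) *s y) (u ` {1..n})"] by auto
      have "inverse (y $ p) *s y \<in> vec.span (insert ?x (s ` {1..n}))"
        unfolding y_def using w1 by (intro vec.span_scale vec.span_diff vec.span_base[of ?x]) auto
      moreover have "?x \<in> vec.span (insert (inverse (y $ p) *s y) (u ` {1..n}))"
      proof -
        have "?x = y $ p *s (inverse (y $ p) *s y) + w"
          using yp by (simp add: y_def)
        thus ?thesis using w2 by (metis insertI1 vec.span_add vec.span_base vec.span_scale)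
      qed
      ultimately show ?thesis
        using sub sub' unfolding vec.span_eq by blast
    qed
    ultimately show ?thesis using True by simp
  qed
  moreover have "supnorm (u' i) \<le> 1 \<and> u' i $ \<pi>' i = 1 \<and> (\<forall>j\<in>{1..<i}. u' i $ \<pi>' j = 0)"
    if "i \<in> {1..Suc n}" for i
  proof (cases "i = Suc n")
    case True
    have "y $ \<pi> j = 0" if "j \<in> {1..n}" for j using w(2)[OF that] by (simp add: y_def)
    thus ?thesis using True yp p by (auto simp: u'_def \<pi>'_def)
  next
    case False
    hence "i \<in> {1..n}" using that by auto
    thus ?thesis using u[of i] by (auto simp: u'_def \<pi>'_def)
  qed
  ultimately show ?case by blast
qed simp

text \<open>Among the coefficients of maximal absolute value take the first, c_j. In the pivot row
  of u_j the later vectors vanish, while the earlier ones have strictly smaller coefficients and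
  entries of absolute value at most 1; so c_j survives in that coordinate.\<close>

lemma ex_orthonormal_flag:
  fixes s :: "nat \<Rightarrow> 'a::{field,finite} fls ^ 'd"
  assumes "\<And>i. i \<in> {1..n} \<Longrightarrow> s i \<notin> vec.span (s ` {1..<i})"
  obtains u where "\<And>k. k \<le> n \<Longrightarrow> vec.span (u ` {1..k}) = vec.span (s ` {1..k})"
    "\<And>i. i \<in> {1..n} \<Longrightarrow> supnorm (u i) \<le> 1"
    "\<And>c i. i \<in> {1..n} \<Longrightarrow> absK (c i) \<le> supnorm (\<Sum>i=1..n. c i *s u i)"
proof -
  obtain u \<pi> where span: "\<And>k. k \<le> n \<Longrightarrow> vec.span (u ` {1..k}) = vec.span (s ` {1..k})"
    and u: "\<And>i. i \<in> {1..n} \<Longrightarrow> supnorm (u i) \<le> 1" "\<And>i. i \<in> {1..n} \<Longrightarrow> u i $ \<pi> i = 1"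
      "\<And>i j. i \<in> {1..n} \<Longrightarrow> j \<in> {1..<i} \<Longrightarrow> u i $ \<pi> j = 0"
    using ex_pivoted_flag[of n s] assms by metis
  have "absK (c i) \<le> supnorm (\<Sum>i=1..n. c i *s u i)" if i: "i \<in> {1..n}" for c i
  proof -
    define M where "M = Max ((\<lambda>i. absK (c i)) ` {1..n})"
    have le: "absK (c j) \<le> M" if "j \<in> {1..n}" for j using that by (simp add: M_def)
    have "M \<in> (\<lambda>i. absK (c i)) ` {1..n}" unfolding M_def using i by (intro Max_in) auto
    then obtain j0 where "j0 \<in> {1..n} \<and> absK (c j0) = M" by auto
    then obtain j where j: "j \<in> {1..n}" "absK (c j) = M"
      and min: "\<And>k. k < j \<Longrightarrow> \<not> (k \<in> {1..n} \<and> absK (c k) = M)"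
      using exists_least_iff[of "\<lambda>j. j \<in> {1..n} \<and> absK (c j) = M"] by blast
    have "M \<le> supnorm (\<Sum>i=1..n. c i *s u i)"
    proof (cases "M = 0")
      case False
      hence M0: "0 < M" using j(2) absK_nonneg[of "c j"] by linarith
      have "(\<Sum>i=1..n. c i *s u i) $ \<pi> j = c j + (\<Sum>i\<in>{1..n}-{j}. c i * u i $ \<pi> j)"
        using j u(2)[of j] by (simp add: sum.remove[of _ j])
      also have "absK \<dots> = absK (c j)"
      proof (rule absK_add_eq)
        have "absK (c k * u k $ \<pi> j) < M" if "k \<in> {1..n} - {j}" for k
        proof (cases "k < j")
          case True
          hence "absK (c k) < M" using le[of k] min[OF True] that by auto
          moreover have "absK (u k $ \<pi> j) \<le> 1"
            using that u(1)[of k] absK_nth_le_supnorm[of "u k" "\<pi> j"] by auto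
          ultimately show ?thesis
            using mult_left_le[of "absK (u k $ \<pi> j)" "absK (c k)"] by auto
        next
          case False
          thus ?thesis using that u(3)[of k j] j M0 by auto
        qed
        thus "absK (\<Sum>i\<in>{1..n}-{j}. c i * u i $ \<pi> j) < absK (c j)"
          unfolding j(2) using M0 by (rule absK_sum_less)
      qed
      finally show ?thesis using absK_nth_le_supnorm[of "\<Sum>i=1..n. c i *s u i" "\<pi> j"] j(2) by simp
    qed simp
    thus ?thesis using le[OF i] by simp
  qed
  thus ?thesis using that span u(1) by blast
qed

subsection \<open>Packing of boxes modulo a lattice\<close>

text \<open>Vectors are numbered by {1..d}, columns by the index type. Another numbering would
  permute columns and change a determinant only by a sign, which \<open>absK\<close> does not
  see.\<close>

definition column_index :: "'d::finite \<Rightarrow> nat" where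
  "column_index = (SOME e. bij_betw e UNIV {1..CARD('d)})"

lemma bij_column_index: "bij_betw column_index (UNIV :: 'd::finite set) {1..CARD('d)}"
proof -
  have "\<exists>e. bij_betw e (UNIV :: 'd set) {1..CARD('d)}"
    by (rule finite_same_card_bij) auto
  thus ?thesis unfolding column_index_def by (rule someI_ex)
qed

lemma sum_column_index:
  "(\<Sum>j\<in>(UNIV :: 'd::finite set). f (column_index j)) = (\<Sum>i=1..CARD('d). f i)"
  by (rule sum.reindex_bij_betw[OF bij_column_index])

lemma prod_column_index:
  "(\<Prod>j\<in>(UNIV :: 'd::finite set). f (column_index j)) = (\<Prod>i=1..CARD('d). f i)"
  by (rule prod.reindex_bij_betw[OF bij_column_index])

lemma column_index_mem [simp]: "column_index (j :: 'd::finite) \<in> {1..CARD('d)}"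
  using bij_column_index bij_betwE by blast

lemma column_index_cases:
  assumes "i \<in> {1..CARD('d::finite)}"
  obtains j :: "'d::finite" where "i = column_index j"
proof -
  have "i \<in> range (column_index :: 'd \<Rightarrow> nat)"
    using assms bij_column_index[where 'd='d] by (simp add: bij_betw_def)
  thus ?thesis using that by blast
qed

definition matrix_of_columns :: "(nat \<Rightarrow> 'a ^ 'd) \<Rightarrow> 'a ^ 'd ^ 'd" where
  "matrix_of_columns v = (\<chi> i j. v (column_index j) $ i)"

lemma matrix_of_columns_mult_vec:
  fixes v :: "nat \<Rightarrow> 'a::field ^ 'd"
  shows "matrix_of_columns v *v (\<chi> j. c (column_index j)) = (\<Sum>i=1..CARD('d). c i *s v i)"
  unfolding Finite_Cartesian_Product.vec_eq_iff
  using sum_column_index[where 'd='d and f = "\<lambda>j. c j * v j $ _"]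
  by (simp add: matrix_vector_mult_def matrix_of_columns_def mult.commute)

lemma vec_as_column_coefficients:
  fixes x :: "'a ^ 'd"
  obtains c where "x = (\<chi> j. c (column_index j))"
proof
  show "x = (\<chi> j. (\<lambda>i. x $ inv_into UNIV column_index i) (column_index j))"
    using bij_column_index[where 'd='d]
    by (simp add: Finite_Cartesian_Product.vec_eq_iff bij_betw_def inv_into_f_f)
qed

lemma det_matrix_of_scaled_columns:
  fixes u :: "nat \<Rightarrow> 'a::field ^ 'd"
  shows "fdet (matrix_of_columns (\<lambda>i. z i *s u i)) = (\<Prod>i=1..CARD('d). z i) * fdet (matrix_of_columns u)"
proof -
  have "fdet (matrix_of_columns (\<lambda>i. z i *s u i)) =
      fdet (\<chi> j. z (column_index j) *s (Finite_Cartesian_Product.transpose (matrix_of_columns u) $ j))"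
    by (subst Determinants.det_transpose[symmetric])
      (simp add: matrix_of_columns_def Finite_Cartesian_Product.transpose_def vector_scalar_mult_def)
  also have "\<dots> = (\<Prod>i=1..CARD('d). z i) * fdet (\<chi> j. Finite_Cartesian_Product.transpose (matrix_of_columns u) $ j)"
    by (subst Determinants.det_rows_mul) (simp add: prod_column_index)
  finally show ?thesis by (simp add: vec_nth_inverse)
qed

section \<open>Lattices and their fundamental cells\<close>

lemma lattice_of_add:
  assumes "x \<in> lattice_of g" "y \<in> lattice_of g"
  shows "x + y \<in> lattice_of g"
proof -
  obtain a b where "x = g *v a" "\<And>i. a $ i \<in> ring_R" "y = g *v b" "\<And>i. b $ i \<in> ring_R"
    using assms by (auto simp: lattice_of_def)
  thus ?thesis
    unfolding lattice_of_def
    by (intro image_eqI[of _ _ "a + b"]) (auto simp: matrix_vector_right_distrib ring_R_add)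
qed

lemma lattice_of_0 [simp]: "0 \<in> lattice_of g"
  unfolding lattice_of_def by (rule image_eqI[of _ _ 0]) auto

lemma lattice_of_scale:
  assumes "r \<in> ring_R" "x \<in> lattice_of g"
  shows "r *s x \<in> lattice_of g"
proof -
  obtain a where "x = g *v a" "\<And>i. a $ i \<in> ring_R"
    using assms by (auto simp: lattice_of_def)
  thus ?thesis
    unfolding lattice_of_def using assms(1)
    by (intro image_eqI[of _ _ "r *s a"]) (auto simp: vector_scalar_commute ring_R_mult)
qed

lemma lattice_of_diff: "x \<in> lattice_of g \<Longrightarrow> y \<in> lattice_of g \<Longrightarrow> x - y \<in> lattice_of g"
  using lattice_of_add[of x g "(- 1) *s y"] lattice_of_scale[OF ring_R_minus[OF ring_R_1], of y g]
  by simp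

lemma lattice_of_sum: "(\<And>i. i \<in> A \<Longrightarrow> f i \<in> lattice_of g) \<Longrightarrow> (\<Sum>i\<in>A. f i) \<in> lattice_of g"
  by (induction A rule: infinite_finite_induct) (auto intro: lattice_of_add)

lemma countable_lattice_of: "countable (lattice_of (g :: 'a::{field,finite} fls ^ 'd ^ 'd))"
proof -
  have "{v :: 'a fls ^ 'd. \<forall>i. v $ i \<in> ring_R} = vec_lambda ` (PiE UNIV (\<lambda>_. ring_R))"
    by (auto simp: image_iff PiE_def Pi_def) (metis vec_lambda_eta)
  thus ?thesis
    unfolding lattice_of_def
    by (auto intro!: countable_image countable_PiE countable_ring_R)
qed

lemma span_lattice_of:
  fixes g :: "'a::{field,finite} fls ^ 'd ^ 'd"
  assumes "invertible g"
  shows "vec.span (lattice_of g) = UNIV"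
proof -
  have "x \<in> vec.span (lattice_of g)" for x
  proof -
    have col: "g *v axis i 1 \<in> lattice_of g" for i
      unfolding lattice_of_def by (intro imageI) (auto simp: axis_def)
    have "matrix_inv g *v x = (\<Sum>i\<in>UNIV. (matrix_inv g *v x) $ i *s axis i 1)"
      by (simp add: basis_expansion)
    hence "g *v (matrix_inv g *v x) = g *v (\<Sum>i\<in>UNIV. (matrix_inv g *v x) $ i *s axis i 1)" by simp
    also have "\<dots> = (\<Sum>i\<in>UNIV. (matrix_inv g *v x) $ i *s (g *v axis i 1))"
      by (simp add: vec.linear_sum vector_scalar_commute vec.sum)
    also have "\<dots> \<in> vec.span (lattice_of g)"
      by (intro vec.span_sum vec.span_scale vec.span_base col)
    finally show ?thesis using assms by simp
  qed
  thus ?thesis by blast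
qed

text \<open>Splitting the coordinates with respect to \<open>g\<close> into polynomial and
  fractional parts shows that the image of the open unit ball is a fundamental domain; uniqueness is
  \<open>lattice_of_plus_ball_unique\<close>.\<close>

lemma ex_lattice_of_plus_ball:
  fixes g :: "'a::{field,finite} fls ^ 'd ^ 'd"
  assumes "invertible g"
  shows "\<exists>u\<in>lattice_of g. x \<in> (+) u ` (*v) g ` {y. supnorm y < 1}"
proof -
  define y where "y = matrix_inv g *v x"
  define f where "f = (\<chi> i. frac_part (y $ i))"
  have "g *v (y - f) \<in> lattice_of g"
    unfolding lattice_of_def by (intro imageI) (simp add: f_def diff_frac_part)
  moreover have "x = g *v (y - f) + g *v f"
    using assms by (simp add: matrix_vector_mult_diff_distrib y_def)
  moreover have "supnorm f < 1" by (simp add: supnorm_less_iff f_def absK_frac_part)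
  ultimately show ?thesis by blast
qed

lemma lattice_of_plus_ball_unique:
  fixes g :: "'a::{field,finite} fls ^ 'd ^ 'd"
  assumes "invertible g" "u \<in> lattice_of g" "u' \<in> lattice_of g"
    "supnorm f < 1" "supnorm f' < 1" "u + g *v f = u' + g *v f'"
  shows "u = u'"
proof -
  obtain r where r: "u - u' = g *v r" "\<And>i. r $ i \<in> ring_R"
    using lattice_of_diff[OF assms(2,3)] by (auto simp: lattice_of_def)
  have "g *v r = g *v (f' - f)"
    using assms(6) r(1) by (simp add: matrix_vector_mult_diff_distrib algebra_simps)
  hence "r = f' - f" by (metis assms(1) matrix_inv_cancel_vec(2))
  hence less: "absK (r $ i) < 1" for i
    using supnorm_diff_le_max[of f' f] absK_nth_le_supnorm[of r i] assms(4,5) by auto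
  have "r $ i = 0" for i using ring_R_absK_ge_1[OF r(2)[of i]] less[of i] by force
  hence "r = 0" by (simp add: Finite_Cartesian_Product.vec_eq_iff)
  thus ?thesis using r(1) by simp
qed

lemma uniformly_open_ball: "uniformly_open {x :: 'a::{field,finite} fls ^ 'd. supnorm x < 1}"
  unfolding uniformly_open_def
proof (intro exI[of _ 1] conjI ballI allI impI)
  fix x y :: "'a fls ^ 'd" assume "x \<in> {x. supnorm x < 1}" "supnorm (y - x) < 1"
  thus "y \<in> {x. supnorm x < 1}" using supnorm_add_le_max[of x "y - x"] by auto
qed simp

text \<open>
  The translates of \<open>W\<close> by \<open>P\<close> are cut along the cells \<open>u + g ball\<close> and moved into one cell,
  where the pieces remain disjoint.
\<close>

lemma lattice_packing:
  fixes g W :: "'a::{field,finite} fls ^ 'd ^ 'd" and m :: "('a fls ^ 'd) measure"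
  assumes haar: "haar_measure m" and g: "invertible g" and W: "invertible W" and P: "finite P"
    and disj: "\<And>p p' w w'. p \<in> P \<Longrightarrow> p' \<in> P \<Longrightarrow> supnorm w < 1 \<Longrightarrow> supnorm w' < 1 \<Longrightarrow>
      (p + W *v w) - (p' + W *v w') \<in> lattice_of g \<Longrightarrow> p = p' \<and> w = w'"
  shows "real (card P) * absK (fdet W) \<le> absK (fdet g)"
proof -
  define L where "L = lattice_of g"
  define B where "B = (*v) W ` {y. supnorm y < 1}"
  define G where "G = (*v) g ` {y. supnorm y < 1}"
  define E where "E = (\<lambda>p u. (+) p ` B \<inter> (+) u ` G)"
  define F where "F = (\<lambda>p. \<Union>u\<in>L. (+) (- u) ` E p u)"
  note open_rules = uniformly_open_translate uniformly_open_Int uniformly_open_image uniformly_open_ball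
  have B: "uniformly_open B" and G: "uniformly_open G"
    unfolding B_def G_def using g W by (auto intro: open_rules)
  have E: "uniformly_open (E p u)" for p u unfolding E_def using B G by (intro open_rules)
  have cL: "countable L" unfolding L_def by (rule countable_lattice_of)
  note sets = haar_sets[OF haar] and trans = haar_translate[OF haar]
  \<comment> \<open>One statement for two disjointness claims: of the pieces within one
    \<open>F p\<close>, and of \<open>F p\<close> and \<open>F p'\<close>. Moving pieces changes
    points by lattice vectors only, which \<open>disj\<close> allows for.\<close>
  have injE: "p = p' \<and> u = u'"
    if pu: "p \<in> P" "p' \<in> P" "u \<in> L" "u' \<in> L" and x: "x \<in> (+) (- u) ` E p u" "x \<in> (+) (- u') ` E p' u'"
    for p p' u u' x
  proof -
    obtain w w' where w: "supnorm w < 1" "supnorm w' < 1" "x = - u + (p + W *v w)" "x = - u' + (p' + W *v w')"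
      using x by (auto simp: E_def B_def)
    hence eq: "(p + W *v w) - (p' + W *v w') = u - u'" by (simp add: algebra_simps)
    hence "(p + W *v w) - (p' + W *v w') \<in> lattice_of g"
      using lattice_of_diff[of u g u'] pu by (simp add: L_def)
    hence "p = p' \<and> w = w'" by (rule disj[OF pu(1,2) w(1,2)])
    thus ?thesis using eq by simp
  qed
  have cover: "\<exists>u\<in>L. x \<in> (+) u ` G" for x
    unfolding L_def G_def by (rule ex_lattice_of_plus_ball[OF g])
  have FG: "F p \<subseteq> G" for p by (auto simp: F_def E_def)
  have measF: "F p \<in> sets m" for p
    unfolding F_def using cL by (intro sets.countable_UN'[OF cL] image_subsetI sets uniformly_open_translate E)
  have "emeasure m (F p) = emeasure m B" if p: "p \<in> P" for p
  proof -
    have "emeasure m (F p) = (\<integral>\<^sup>+ u. emeasure m ((+) (- u) ` E p u) \<partial>count_space L)"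
      unfolding F_def
    proof (rule emeasure_UN_countable)
      show "disjoint_family_on (\<lambda>u. (+) (- u) ` E p u) L"
        unfolding disjoint_family_on_def using injE[OF p p] by blast
    qed (intro cL sets uniformly_open_translate E)+
    also have "\<dots> = (\<integral>\<^sup>+ u. emeasure m (E p u) \<partial>count_space L)"
      unfolding trans[OF E] ..
    also have "\<dots> = emeasure m (\<Union>u\<in>L. E p u)"
    proof (rule emeasure_UN_countable[symmetric])
      show "disjoint_family_on (E p) L"
        unfolding disjoint_family_on_def
      proof (intro ballI impI, rule ccontr)
        fix u u' assume u: "u \<in> L" "u' \<in> L" "u \<noteq> u'" "E p u \<inter> E p u' \<noteq> {}"
        then obtain x where "x \<in> (+) u ` G" "x \<in> (+) u' ` G" unfolding E_def by blast
        then obtain f f' where "supnorm f < 1" "x = u + g *v f" "supnorm f' < 1" "x = u' + g *v f'"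
          unfolding G_def by blast
        thus False using lattice_of_plus_ball_unique[OF g] u by (auto simp: L_def)
      qed
    qed (use cL E in \<open>auto intro: sets\<close>)
    also have "(\<Union>u\<in>L. E p u) = (+) p ` B" using cover unfolding E_def by blast
    finally show ?thesis by (simp add: trans[OF B])
  qed
  hence "of_nat (card P) * emeasure m B = (\<Sum>p\<in>P. emeasure m (F p))" by simp
  also have "\<dots> = emeasure m (\<Union>p\<in>P. F p)"
  proof (rule sum_emeasure)
    show "disjoint_family_on F P"
      unfolding disjoint_family_on_def F_def using injE by blast
  qed (use measF P in auto)
  also have "\<dots> \<le> emeasure m G"
    using FG by (intro emeasure_mono sets G) auto
  finally have "of_nat (card P) * ennreal (absK (fdet W) / real CARD('a) ^ CARD('d))
      \<le> ennreal (absK (fdet g) / real CARD('a) ^ CARD('d))"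
    unfolding B_def G_def emeasure_image_open_unit_ball[OF haar W] emeasure_image_open_unit_ball[OF haar g] .
  hence "ennreal (real (card P) * (absK (fdet W) / real CARD('a) ^ CARD('d)))
      \<le> ennreal (absK (fdet g) / real CARD('a) ^ CARD('d))"
    by (subst ennreal_mult) (simp_all add: ennreal_of_nat_eq_real_of_nat)
  hence "real (card P) * (absK (fdet W) / real CARD('a) ^ CARD('d)) \<le> absK (fdet g) / real CARD('a) ^ CARD('d)"
    by (subst (asm) ennreal_le_iff) auto
  thus ?thesis using card_field_gt_1[where 'a='a] by (simp add: divide_le_cancel)
qed

text \<open>Let k be the last index at which a nonzero box point has a coefficient along the
  orthonormal flag u. The point is shorter than s_k. Were it in \<open>S\<close>, it would lie in
  the span of s_1, ..., s_(k-1), which is that of u_1, ..., u_(k-1), contradicting the nonzero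
  coefficient at u_k.\<close>

lemma prod_greedy_le:
  fixes g :: "'a::{field,finite} fls ^ 'd ^ 'd" and m :: "('a fls ^ 'd) measure"
  assumes haar: "haar_measure m" and g: "invertible g" and P: "finite P"
    and S: "S = (\<Union>p\<in>P. (+) p ` lattice_of g)"
    and diff: "\<And>x y. x \<in> S \<Longrightarrow> y \<in> S \<Longrightarrow> x - y \<in> S"
    and distinct: "\<And>p p'. p \<in> P \<Longrightarrow> p' \<in> P \<Longrightarrow> p - p' \<in> lattice_of g \<Longrightarrow> p = p'"
    and s: "greedy S s"
  shows "real (card P) * (\<Prod>i=1..CARD('d). supnorm (s i)) \<le> absK (fdet g)"
proof -
  let ?d = "CARD('d)"
  have nspan: "s i \<notin> vec.span (s ` {1..<i})" if "i \<in> {1..?d}" for i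
    using s that unfolding greedy_def by blast
  obtain u where span: "\<And>k. k \<le> ?d \<Longrightarrow> vec.span (u ` {1..k}) = vec.span (s ` {1..k})"
    and u1: "\<And>i. i \<in> {1..?d} \<Longrightarrow> supnorm (u i) \<le> 1"
    and u2: "\<And>c i. i \<in> {1..?d} \<Longrightarrow> absK (c i) \<le> supnorm (\<Sum>i=1..?d. c i *s u i)"
    using ex_orthonormal_flag[of ?d s] nspan by blast
  \<comment> \<open>The two norm properties of the flag make its matrix an isometry, so the
    determinant of the box comes from its side lengths alone.\<close>
  have "supnorm (matrix_of_columns u *v x) = supnorm x" for x
  proof -
    obtain c where c: "x = (\<chi> j. c (column_index j))" by (rule vec_as_column_coefficients)
    show ?thesis
    proof (rule antisym)
      show "supnorm (matrix_of_columns u *v x) \<le> supnorm x"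
        using supnorm_matrix_vector_mult_le[of "matrix_of_columns u" 1 x]
          order_trans[OF absK_nth_le_supnorm u1[OF column_index_mem]]
        by (simp add: matrix_of_columns_def)
      show "supnorm x \<le> supnorm (matrix_of_columns u *v x)"
        unfolding supnorm_le_iff c matrix_of_columns_mult_vec using u2[OF column_index_mem] by simp
    qed
  qed
  note U = isometry_absK_det[OF this]
  \<comment> \<open>The norm is attained at a coordinate, so each side length is the absolute value
    of a field element.\<close>
  have "\<exists>z :: 'a fls. absK z = supnorm (s i)" for i
    by (rule ex_absK_nth_eq_supnorm[of "s i"]) (rule exI, erule sym)
  then obtain z :: "nat \<Rightarrow> 'a fls" where z: "\<And>i. absK (z i) = supnorm (s i)" by metis
  have s0: "s i \<noteq> 0" if "i \<in> {1..?d}" for i using nspan[OF that] vec.span_zero by metis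
  hence z0: "z i \<noteq> 0" if "i \<in> {1..?d}" for i using z[of i] that by auto
  define W where "W = matrix_of_columns (\<lambda>i. z i *s u i)"
  have detW: "absK (fdet W) = (\<Prod>i=1..?d. supnorm (s i))"
    unfolding W_def det_matrix_of_scaled_columns by (simp add: U absK_prod z)
  have "(\<Prod>i=1..?d. supnorm (s i)) \<noteq> 0" using s0 by simp
  hence W: "invertible W" using detW by (auto simp: invertible_det_nz)
  have key: "w = 0" if w: "supnorm w < 1" "W *v w \<in> S" for w
  proof (rule ccontr)
    assume "w \<noteq> 0"
    obtain c where c: "w = (\<chi> j. c (column_index j))" by (rule vec_as_column_coefficients)
    have c1: "absK (c i) < 1" if i: "i \<in> {1..?d}" for i
    proof -
      obtain j :: 'd where "i = column_index j" using column_index_cases[OF i] .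
      thus ?thesis using w(1) by (simp add: c supnorm_less_iff)
    qed
    obtain j :: 'd where "c (column_index j) \<noteq> 0"
      using \<open>w \<noteq> 0\<close> by (auto simp: c Finite_Cartesian_Product.vec_eq_iff)
    hence "\<exists>i\<in>{1..?d}. c i \<noteq> 0" by (rule bexI) (rule column_index_mem)
    hence ne: "{i \<in> {1..?d}. c i \<noteq> 0} \<noteq> {}" by blast
    define k where "k = Max {i \<in> {1..?d}. c i \<noteq> 0}"
    have "k \<in> {i \<in> {1..?d}. c i \<noteq> 0}" unfolding k_def using ne by (intro Max_in) auto
    hence k: "k \<in> {1..?d}" "c k \<noteq> 0" by auto
    have above: "c i = 0" if i: "i \<in> {1..?d}" "k < i" for i
    proof (rule ccontr)
      assume "c i \<noteq> 0"
      hence "i \<le> k" unfolding k_def using i(1) by (intro Max_ge) simp_all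
      thus False using i(2) by simp
    qed
    have Ww: "W *v w = (\<Sum>i=1..?d. (c i * z i) *s u i)"
      unfolding W_def c matrix_of_columns_mult_vec by (simp add: vector_smult_assoc)
    have sk: "0 < supnorm (s k)" using s0[OF k(1)] by simp
    have "supnorm (W *v w) < supnorm (s k)"
    proof -
      have "absK (((c i * z i) *s u i) $ l) < supnorm (s k)" if i: "i \<in> {1..?d}" for i l
      proof (cases "k < i")
        case True
        thus ?thesis using above[OF i] sk by simp
      next
        case False
        have "absK (((c i * z i) *s u i) $ l) \<le> absK (c i * z i)"
          using order_trans[OF absK_nth_le_supnorm u1[OF i], of l] by (simp add: mult_left_le)
        also have "\<dots> < supnorm (s i)" using c1[OF i] s0[OF i] by (simp add: z)
        also have "\<dots> \<le> supnorm (s k)" using greedy_mono[OF s, of i k] i k False by auto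
        finally show ?thesis .
      qed
      thus ?thesis unfolding Ww supnorm_less_iff using sk by (auto intro!: absK_sum_less)
    qed
    hence mem: "W *v w \<in> vec.span (s ` {1..<k})"
      using s w(2) k(1) unfolding greedy_def by (meson not_less)
    have eq: "vec.span (s ` {1..<k}) = vec.span (u ` {1..<k})"
      using span[of "k - 1"] k(1) by (cases k) (auto simp: atLeastLessThanSuc_atLeastAtMost)
    have split: "W *v w = (c k * z k) *s u k + (\<Sum>i\<in>{1..<k}. (c i * z i) *s u i)"
    proof -
      have "W *v w = (\<Sum>i\<in>{1..k}. (c i * z i) *s u i)"
        unfolding Ww using k(1) above by (intro sum.mono_neutral_right) auto
      also have "{1..k} = insert k {1..<k}" using k(1) by auto
      finally show ?thesis by simp
    qed
    have "(\<Sum>i\<in>{1..<k}. (c i * z i) *s u i) \<in> vec.span (u ` {1..<k})"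
      by (intro vec.span_sum vec.span_scale vec.span_base) auto
    from vec.span_diff[OF mem[unfolded eq] this]
    have "(c k * z k) *s u k \<in> vec.span (u ` {1..<k})" by (simp add: split)
    hence "inverse (c k * z k) *s ((c k * z k) *s u k) \<in> vec.span (u ` {1..<k})"
      by (rule vec.span_scale)
    moreover have "inverse (c k * z k) * (c k * z k) = 1" using k z0[OF k(1)] by (intro left_inverse) simp
    ultimately have "u k \<in> vec.span (u ` {1..<k})" by (simp only: vector_smult_assoc vector_smult_lid)
    moreover have "{1..k} = insert k {1..<k}" using k(1) by auto
    ultimately have "vec.span (u ` {1..k}) = vec.span (u ` {1..<k})"
      by (simp add: vec.span_redundant)
    hence "s k \<in> vec.span (s ` {1..<k})"
      using span[of k] eq k(1) vec.span_base[of "s k" "s ` {1..k}"] by auto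
    thus False using nspan[OF k(1)] by blast
  qed
  have "real (card P) * absK (fdet W) \<le> absK (fdet g)"
  proof (rule lattice_packing[OF haar g W P])
    fix p p' w w' assume p: "p \<in> P" "p' \<in> P" and w: "supnorm w < 1" "supnorm w' < 1"
      and mem: "(p + W *v w) - (p' + W *v w') \<in> lattice_of g"
    let ?l = "(p + W *v w) - (p' + W *v w')"
    \<comment> \<open>Both summands on the right lie in the group \<open>S\<close>, hence so does
      this difference of box points. It is a box point again, so no factor 2 enters as over the
      reals.\<close>
    have "W *v (w - w') = (p' + ?l) - (p + 0)" by (simp add: matrix_vector_mult_diff_distrib)
    moreover have "p' + ?l \<in> S" "p + 0 \<in> S" using p mem unfolding S by (blast intro: lattice_of_0)+
    ultimately have "W *v (w - w') \<in> S" using diff by metis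
    moreover have "supnorm (w - w') < 1" using supnorm_diff_le_max[of w w'] w by linarith
    ultimately have "w = w'" using key[of "w - w'"] by simp
    moreover from this have "p = p'" using mem distinct[OF p] by simp
    ultimately show "p = p' \<and> w = w'" by simp
  qed
  thus ?thesis by (simp add: detW)
qed

subsection \<open>Reduced bases\<close>

lemma independent_family:
  fixes v :: "nat \<Rightarrow> 'a::field ^ 'd"
  assumes "vec.independent (v ` I)" "inj_on v I" "finite I" "(\<Sum>i\<in>I. c i *s v i) = 0" "i \<in> I"
  shows "c i = 0"
proof -
  have "(\<Sum>x\<in>v ` I. c (inv_into I v x) *s x) = (\<Sum>i\<in>I. c i *s v i)"
    using assms(2) by (simp add: sum.reindex)
  hence "c (inv_into I v (v i)) = 0"
    using assms by (intro vec.independentD[OF assms(1), of "v ` I"]) auto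
  thus ?thesis using assms(2,5) by simp
qed

lemma invertible_matrix_of_columns:
  fixes v :: "nat \<Rightarrow> 'a::field ^ 'd"
  assumes "vec.independent (v ` {1..CARD('d)})" "inj_on v {1..CARD('d)}"
  shows "invertible (matrix_of_columns v)"
proof -
  have "x = 0" if x: "matrix_of_columns v *v x = 0" for x
  proof -
    obtain c where c: "x = (\<chi> j. c (column_index j))" by (rule vec_as_column_coefficients)
    hence "(\<Sum>i=1..CARD('d). c i *s v i) = 0" using x by (simp add: matrix_of_columns_mult_vec)
    hence "c (column_index j) = 0" for j :: 'd
      using independent_family[OF assms, of c] column_index_mem by blast
    thus "x = 0" by (simp add: c Finite_Cartesian_Product.vec_eq_iff)
  qed
  hence "\<exists>B. B ** matrix_of_columns v = Finite_Cartesian_Product.mat 1"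
    unfolding matrix_left_invertible_ker by blast
  thus ?thesis by (simp add: invertible_left_inverse)
qed

lemma finite_vectors:
  assumes "finite F"
  shows "finite {x :: 'a ^ 'd::finite. \<forall>i. x $ i \<in> F}"
proof -
  have "{x :: 'a ^ 'd. \<forall>i. x $ i \<in> F} \<subseteq> vec_lambda ` (PiE UNIV (\<lambda>_. F))"
    by (auto simp: image_iff PiE_def Pi_def) (metis vec_lambda_eta)
  thus ?thesis by (rule finite_subset) (intro finite_imageI finite_PiE, use assms in auto)
qed

lemma locally_finite_lattice_of:
  fixes g :: "'a::{field,finite} fls ^ 'd ^ 'd"
  assumes "invertible g"
  shows "locally_finite (lattice_of g)"
  unfolding locally_finite_def
proof
  fix r
  obtain c where c: "c > 0" "\<And>x. supnorm (matrix_inv g *v x) \<le> c * supnorm x"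
    using ex_matrix_vector_mult_bound[of "matrix_inv g"] by blast
  let ?F = "{f :: 'a fls. f \<in> ring_R \<and> absK f \<le> c * r}"
  have "lattice_of g \<inter> {x. supnorm x \<le> r} \<subseteq> (*v) g ` {x. \<forall>i. x $ i \<in> ?F}"
  proof
    fix x assume x: "x \<in> lattice_of g \<inter> {x. supnorm x \<le> r}"
    then obtain y where y: "x = g *v y" "\<And>i. y $ i \<in> ring_R" by (auto simp: lattice_of_def)
    have "supnorm y \<le> c * supnorm x" using c(2)[of x] assms by (simp add: y)
    also have "\<dots> \<le> c * r" using x c(1) by simp
    finally have "absK (y $ i) \<le> c * r" for i using absK_nth_le_supnorm order_trans by blast
    thus "x \<in> (*v) g ` {x. \<forall>i. x $ i \<in> ?F}" using y by blast
  qed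
  thus "finite (lattice_of g \<inter> {x. supnorm x \<le> r})"
    by (rule finite_subset) (intro finite_imageI finite_vectors finite_ring_R_bounded)
qed

lemma locally_finite_translates:
  assumes L: "locally_finite L" and P: "finite P"
  shows "locally_finite (\<Union>p\<in>P. (+) p ` L)"
  unfolding locally_finite_def
proof
  fix r
  have "(\<Union>p\<in>P. (+) p ` L) \<inter> {x. supnorm x \<le> r}
      \<subseteq> (\<Union>p\<in>P. (+) p ` (L \<inter> {x. supnorm x \<le> max r (supnorm p)}))"
  proof
    fix x assume "x \<in> (\<Union>p\<in>P. (+) p ` L) \<inter> {x. supnorm x \<le> r}"
    then obtain p y where p: "p \<in> P" "y \<in> L" "x = p + y" "supnorm x \<le> r" by blast
    have "supnorm y \<le> max r (supnorm p)"
      using supnorm_diff_le_max[of x p] p by (auto simp: max_def split: if_splits)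
    thus "x \<in> (\<Union>p\<in>P. (+) p ` (L \<inter> {x. supnorm x \<le> max r (supnorm p)}))" using p by blast
  qed
  thus "finite ((\<Union>p\<in>P. (+) p ` L) \<inter> {x. supnorm x \<le> r})"
    by (rule finite_subset) (use L P in \<open>auto simp: locally_finite_def\<close>)
qed

lemma ring_R_det:
  fixes A :: "'a::{field,finite} fls ^ 'd ^ 'd"
  assumes "\<And>i j. A $ i $ j \<in> ring_R"
  shows "fdet A \<in> ring_R"
  unfolding Determinants.det_def
  by (intro ring_R_sum ring_R_mult ring_R_prod assms) (auto simp: sign_def intro: ring_R_minus)

text \<open>Only independence and minimal lengths are demanded; that such a system generates the
  lattice is proved below.\<close>

definition reduced_basis :: "('a::{field,finite} fls ^ 'd) set \<Rightarrow> (nat \<Rightarrow> 'a fls ^ 'd) \<Rightarrow> bool" where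
  "reduced_basis L v \<longleftrightarrow> (\<forall>i\<in>{1..CARD('d)}. v i \<in> L \<and> supnorm (v i) = unit_min L i) \<and>
     inj_on v {1..CARD('d)} \<and> vec.independent (v ` {1..CARD('d)})"

text \<open>
  Minkowski's upper bound for \<open>\<Prod>\<parallel>v i\<parallel>\<close> and Hadamard's lower bound coincide; the index of the
  sublattice spanned by \<open>v\<close> is therefore 1, and equality in Hadamard means that \<open>v\<close> is orthogonal.
\<close>

lemma reduced_basis_lattice_of:
  fixes g :: "'a::{field,finite} fls ^ 'd ^ 'd" and m :: "('a fls ^ 'd) measure"
  assumes haar: "haar_measure m" and g: "invertible g" and v: "reduced_basis (lattice_of g) v"
  shows prod_supnorm_reduced_basis: "(\<Prod>i=1..CARD('d). supnorm (v i)) = absK (fdet g)"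
    and reduced_basis_integral: "\<And>x. x \<in> lattice_of g \<Longrightarrow>
      \<exists>c. (\<forall>i\<in>{1..CARD('d)}. c i \<in> ring_R) \<and> x = (\<Sum>i=1..CARD('d). c i *s v i)"
    and reduced_basis_orthogonal: "\<And>c i. i \<in> {1..CARD('d)} \<Longrightarrow>
      absK (c i) * supnorm (v i) \<le> supnorm (\<Sum>i=1..CARD('d). c i *s v i)"
proof -
  let ?d = "CARD('d)"
  obtain s where s: "greedy (lattice_of g) s"
    using ex_greedy[OF locally_finite_lattice_of[OF g] span_lattice_of[OF g]] by blast
  have "supnorm (v i) = supnorm (s i)" if "i \<in> {1..?d}" for i
    using v that unit_min_greedy[OF s that] by (simp add: reduced_basis_def)
  \<comment> \<open>The packing bound for the lattice alone, with 0 as the only class.\<close>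
  moreover have "real (card {0 :: 'a fls ^ 'd}) * (\<Prod>i=1..?d. supnorm (s i)) \<le> absK (fdet g)"
    by (rule prod_greedy_le[OF haar g _ _ _ _ s]) (auto intro: lattice_of_diff)
  ultimately have upper: "(\<Prod>i=1..?d. supnorm (v i)) \<le> absK (fdet g)" by simp
  have "\<exists>r. v i = g *v r \<and> (\<forall>j. r $ j \<in> ring_R)" if "i \<in> {1..?d}" for i
    using v that by (auto simp: reduced_basis_def lattice_of_def)
  then obtain n where n: "\<And>i. i \<in> {1..?d} \<Longrightarrow> v i = g *v n i"
    "\<And>i j. i \<in> {1..?d} \<Longrightarrow> n i $ j \<in> ring_R" by metis
  let ?M = "matrix_of_columns v" and ?N = "matrix_of_columns n"
  have "?M $ i $ j = (g ** ?N) $ i $ j" for i j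
    using n(1)[OF column_index_mem[of j]]
    by (simp add: matrix_of_columns_def matrix_matrix_mult_def matrix_vector_mult_def)
  hence MN: "?M = g ** ?N" by (simp add: Finite_Cartesian_Product.vec_eq_iff)
  have Nint: "?N $ i $ j \<in> ring_R" for i j
    using n(2)[OF column_index_mem] by (simp add: matrix_of_columns_def)
  have M: "invertible ?M" using v by (intro invertible_matrix_of_columns) (auto simp: reduced_basis_def)
  hence detM: "fdet ?M \<noteq> 0" by (simp add: invertible_det_nz)
  have detMN: "fdet ?M = fdet g * fdet ?N" unfolding MN by (rule det_mul)
  have detg: "fdet g \<noteq> 0" using g by (simp add: invertible_det_nz)
  have detN: "fdet ?N \<noteq> 0" using detM detMN by auto
  have detN_ge: "1 \<le> absK (fdet ?N)" by (rule ring_R_absK_ge_1[OF ring_R_det[OF Nint] detN])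
  have entry: "absK (?M $ i $ j) \<le> supnorm (v (column_index j))" for i j
    by (simp add: matrix_of_columns_def absK_nth_le_supnorm)
  have "absK (fdet ?M) \<le> (\<Prod>j\<in>(UNIV::'d set). supnorm (v (column_index j)))"
    by (rule absK_det_le[OF entry]) simp
  hence hadamard: "absK (fdet g) * absK (fdet ?N) \<le> (\<Prod>i=1..?d. supnorm (v i))"
    by (simp add: prod_column_index[where f = "\<lambda>i. supnorm (v i)"] detMN)
  have "absK (fdet g) * 1 \<le> absK (fdet g) * absK (fdet ?N)"
    by (rule mult_left_mono[OF detN_ge]) simp
  hence prod: "(\<Prod>i=1..?d. supnorm (v i)) = absK (fdet g)" using upper hadamard by simp
  thus "(\<Prod>i=1..?d. supnorm (v i)) = absK (fdet g)" .
  have "absK (fdet g) * absK (fdet ?N) \<le> absK (fdet g) * 1" using hadamard prod by simp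
  hence detN1: "absK (fdet ?N) = 1" using detN_ge detg by simp
  have N: "invertible ?N" using detN by (simp add: invertible_det_nz)

  show "\<exists>c. (\<forall>i\<in>{1..?d}. c i \<in> ring_R) \<and> x = (\<Sum>i=1..?d. c i *s v i)" if x: "x \<in> lattice_of g" for x
  proof -
    obtain r where r: "x = g *v r" "\<And>i. r $ i \<in> ring_R" using x by (auto simp: lattice_of_def)
    define y where "y = matrix_inv ?N *v r"
    have Ny: "?N *v y = r" using N by (simp add: y_def)
    obtain c where c: "y = (\<chi> j. c (column_index j))" by (rule vec_as_column_coefficients)
    have "y $ k \<in> ring_R" for k
    proof -
      \<comment> \<open>By Cramer's rule this product is the determinant of a matrix of polynomials,
        and \<open>fdet ?N\<close> is a unit among them.\<close>
      have "y $ k * fdet ?N \<in> ring_R"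
        unfolding det_replace_column[of ?N k y, symmetric] Ny
        by (rule ring_R_det) (simp add: replace_column_def r Nint)
      from ring_R_mult[OF this ring_R_inverse[OF ring_R_det[OF Nint] detN1]]
      show ?thesis by (simp only: mult.assoc right_inverse[OF detN] mult_1_right)
    qed
    hence "c i \<in> ring_R" if "i \<in> {1..?d}" for i
    proof -
      obtain j :: 'd where "i = column_index j" using column_index_cases[OF \<open>i \<in> {1..?d}\<close>] .
      thus ?thesis using \<open>\<And>k. y $ k \<in> ring_R\<close>[of j] by (simp add: c)
    qed
    moreover have "x = (\<Sum>i=1..?d. c i *s v i)"
      unfolding matrix_of_columns_mult_vec[symmetric] c[symmetric] MN r(1) Ny[symmetric]
      by (simp add: matrix_vector_mul_assoc)
    ultimately show ?thesis by blast
  qed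

  show "absK (c i) * supnorm (v i) \<le> supnorm (\<Sum>i=1..?d. c i *s v i)" if i: "i \<in> {1..?d}" for c i
  proof -
    obtain k :: 'd where k: "i = column_index k" using column_index_cases[OF i] .
    define x :: "'a fls ^ 'd" where "x = (\<chi> j. c (column_index j))"
    let ?R = "\<Prod>j\<in>UNIV-{k}. supnorm (v (column_index j))"
    \<comment> \<open>Equality in Hadamard. The product \<open>?R\<close> of the other lengths
      therefore cancels from the Cramer estimate and leaves the length of
      \<open>v i\<close>.\<close>
    have "absK (fdet ?M) = (\<Prod>j\<in>(UNIV::'d set). supnorm (v (column_index j)))"
      unfolding prod_column_index[where f = "\<lambda>i. supnorm (v i)"] prod detMN
      by (simp add: detN1)
    also have "\<dots> = supnorm (v i) * ?R" unfolding k by (rule prod.remove) auto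
    finally have det: "absK (fdet ?M) = supnorm (v i) * ?R" .
    have "?R \<noteq> 0"
    proof
      assume "?R = 0"
      hence "absK (fdet ?M) = 0" unfolding det by (simp only: mult_zero_right)
      thus False using detM by simp
    qed
    moreover have "0 \<le> ?R" by (intro prod_nonneg) simp
    ultimately have R: "0 < ?R" by linarith
    have "absK (x $ k) * absK (fdet ?M) \<le> supnorm (?M *v x) * ?R"
      by (rule absK_coord_mult_det_le[OF entry]) simp
    hence "absK (c i) * supnorm (v i) * ?R \<le> supnorm (\<Sum>i=1..?d. c i *s v i) * ?R"
      unfolding det by (simp add: x_def matrix_of_columns_mult_vec k mult_ac)
    thus ?thesis using R by (simp add: mult_le_cancel_right)
  qed
qed

section \<open>Kronecker sets as finite unions of classes\<close>

lemma kronecker_set_eq: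
  "kronecker_set L \<alpha> N = (\<Union>p\<in>(\<lambda>Q. poly_embed Q *s \<alpha>) ` polys_le N. (+) p ` L)"
  by (simp add: kronecker_set_def)

lemma lattice_subset_kronecker_set: "L \<subseteq> kronecker_set L \<alpha> N"
  unfolding kronecker_set_def by (force intro: bexI[of _ 0])

lemma kronecker_set_diff:
  assumes "x \<in> kronecker_set (lattice_of g) \<alpha> N" "y \<in> kronecker_set (lattice_of g) \<alpha> N"
  shows "x - y \<in> kronecker_set (lattice_of g) \<alpha> N"
proof -
  obtain Q R u w where Q: "Q \<in> polys_le N" "u \<in> lattice_of g" "x = poly_embed Q *s \<alpha> + u"
    "R \<in> polys_le N" "w \<in> lattice_of g" "y = poly_embed R *s \<alpha> + w"
    using assms by (auto simp: kronecker_set_def)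
  have "x - y = poly_embed (Q - R) *s \<alpha> + (u - w)"
    unfolding Q poly_embed_diff vec.scale_left_diff_distrib by simp
  moreover have "Q - R \<in> polys_le N" "u - w \<in> lattice_of g"
    using Q by (simp_all add: polys_le_diff lattice_of_diff)
  ultimately show ?thesis unfolding kronecker_set_def by (intro UN_I image_eqI)
qed

lemma locally_finite_kronecker_set:
  "invertible g \<Longrightarrow> locally_finite (kronecker_set (lattice_of g) \<alpha> N)"
  unfolding kronecker_set_eq
  by (intro locally_finite_translates locally_finite_lattice_of finite_imageI finite_polys_le)

text \<open>\<open>distinct\<close> speaks of single multiples of \<alpha>; since differences of
  polynomials of degree at most N are of the same kind, it separates all q^(N+1) classes, and the
  packing bound applies with one representative each.\<close>

lemma prod_unit_min_kronecker_set_le: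
  fixes g :: "'a::{field,finite} fls ^ 'd ^ 'd" and m :: "('a fls ^ 'd) measure"
  assumes haar: "haar_measure m" and g: "invertible g"
    and distinct: "\<And>Q. Q \<in> polys_le N \<Longrightarrow> poly_embed Q *s \<alpha> \<in> lattice_of g \<Longrightarrow> Q = 0"
  shows "real CARD('a) ^ (N + 1) * (\<Prod>i=1..CARD('d). unit_min (kronecker_set (lattice_of g) \<alpha> N) i)
    \<le> absK (fdet g)"
proof -
  let ?S = "kronecker_set (lattice_of g) \<alpha> N" and ?p = "\<lambda>Q. poly_embed Q *s \<alpha>"
  have "vec.span ?S = UNIV"
    using vec.span_mono[OF lattice_subset_kronecker_set] span_lattice_of[OF g] by blast
  then obtain s where s: "greedy ?S s"
    using ex_greedy[OF locally_finite_kronecker_set[OF g]] by blast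
  have dist: "Q = R" if "Q \<in> polys_le N" "R \<in> polys_le N" "?p Q - ?p R \<in> lattice_of g" for Q R
    using distinct[of "Q - R"] that polys_le_diff[of Q N R]
    by (simp add: poly_embed_diff vec.scale_left_diff_distrib)
  have "real (card (?p ` polys_le N)) * (\<Prod>i=1..CARD('d). supnorm (s i)) \<le> absK (fdet g)"
    by (rule prod_greedy_le[OF haar g _ kronecker_set_eq kronecker_set_diff _ s])
      (use dist in \<open>auto intro: finite_imageI\<close>)
  moreover have "inj_on ?p (polys_le N)"
    using dist by (auto intro!: inj_onI)
  moreover have "(\<Prod>i=1..CARD('d). unit_min ?S i) = (\<Prod>i=1..CARD('d). supnorm (s i))"
    using unit_min_greedy[OF s] by (intro prod.cong) auto
  ultimately show ?thesis by (simp add: card_image card_polys_le)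
qed

subsection \<open>Minors of fractional parts\<close>

abbreviation "mdet \<equiv> Determinant.det"

lemma frac_matrix_carrier [simp]: "frac_matrix k Q a j \<in> carrier_mat k k"
  by (simp add: frac_matrix_def)

text \<open>Hadamard's inequality with weights: each Leibniz term merely permutes the
  \<open>w l\<close>, so multiplied by all of them it is at most the product of the
  \<open>r i\<close>. Later \<open>w\<close> holds lengths of basis vectors and \<open>r\<close>
  lengths of fractional vectors.\<close>

lemma absK_mdet_mult_le:
  fixes A :: "'a::{field,finite} fls mat"
  assumes A: "A \<in> carrier_mat k k"
    and le: "\<And>i l. i < k \<Longrightarrow> l < k \<Longrightarrow> absK (A $$ (i, l)) * w l \<le> r i"
    and w: "\<And>l. l < k \<Longrightarrow> 0 < w l"
  shows "absK (mdet A) * (\<Prod>l<k. w l) \<le> (\<Prod>i<k. r i)"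
proof -
  have W: "0 < (\<Prod>l<k. w l)" using w by (intro prod_pos) auto
  have r: "0 \<le> r i" if "i < k" for i
    using le[OF that that] w[OF that] by (meson absK_nonneg less_imp_le mult_nonneg_nonneg order_trans)
  have "absK (mdet A) \<le> (\<Prod>i<k. r i) / (\<Prod>l<k. w l)"
    unfolding det_def'[OF A]
  proof (rule absK_sum_le)
    fix p assume "p \<in> {p. p permutes {0..<k}}"
    hence p: "p permutes {..<k}" by (simp add: atLeast0LessThan)
    have "absK (signof p :: 'a fls) = 1" by (simp add: sign_def)
    hence "absK (signof p * (\<Prod>i = 0..<k. A $$ (i, p i))) = (\<Prod>i<k. absK (A $$ (i, p i)))"
      by (simp add: absK_prod atLeast0LessThan)
    moreover have "(\<Prod>i<k. absK (A $$ (i, p i))) * (\<Prod>l<k. w l) \<le> (\<Prod>i<k. r i)"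
    proof -
      have "(\<Prod>l<k. w l) = (\<Prod>i<k. w (p i))"
        using prod.permute[OF p, of w] by (simp add: o_def)
      hence "(\<Prod>i<k. absK (A $$ (i, p i))) * (\<Prod>l<k. w l) = (\<Prod>i<k. absK (A $$ (i, p i)) * w (p i))"
        by (simp add: prod.distrib)
      also have "\<dots> \<le> (\<Prod>i<k. r i)"
      proof (rule prod_mono)
        fix i assume "i \<in> {..<k}"
        moreover from this have "p i < k" using permutes_in_image[OF p, of i] by simp
        ultimately show "0 \<le> absK (A $$ (i, p i)) * w (p i) \<and> absK (A $$ (i, p i)) * w (p i) \<le> r i"
          using le w[of "p i"] by (simp add: less_imp_le)
      qed
      finally show ?thesis .
    qed
    ultimately show "absK (signof p * (\<Prod>i = 0..<k. A $$ (i, p i))) \<le> (\<Prod>i<k. r i) / (\<Prod>l<k. w l)"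
      using W by (simp add: pos_le_divide_eq)
  qed (use W r in \<open>auto intro!: divide_nonneg_pos prod_nonneg\<close>)
  thus ?thesis using W by (simp add: pos_le_divide_eq)
qed

lemma ex_index_choice:
  assumes "J \<subseteq> {1..d}" "card J = k"
  obtains j where "index_choice d k j" "bij_betw (\<lambda>l. j (Suc l)) {..<k} J"
proof -
  have "finite J" using assms(1) finite_subset by blast
  then obtain h where h: "bij_betw h {..<card J} J" "strict_mono_on {..<card J} h"
    by (rule ex_bij_betw_strict_mono_card)
  \<comment> \<open>The increasing enumeration is 0-based, \<open>index_choice\<close> is 1-based;
    composing with \<open>Suc\<close> gives \<open>h\<close> back.\<close>
  let ?j = "\<lambda>i. h (i - 1)"
  have "strict_mono_on {1..k} ?j"
  proof (rule strict_mono_onI)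
    fix r s assume "r \<in> {1..k}" "s \<in> {1..k}" "r < s"
    thus "h (r - 1) < h (s - 1)" using assms(2) by (intro strict_mono_onD[OF h(2)]) auto
  qed
  moreover have "?j ` {1..k} \<subseteq> J"
  proof
    fix x assume "x \<in> ?j ` {1..k}"
    then obtain i where "x = h (i - 1)" "i - 1 < card J" using assms(2) by force
    thus "x \<in> J" using h(1) by (auto simp: bij_betw_def)
  qed
  ultimately have "index_choice d k ?j" using assms(1) unfolding index_choice_def by blast
  moreover have "bij_betw (\<lambda>l. ?j (Suc l)) {..<k} J" using h(1) assms(2) by simp
  ultimately show ?thesis using that by blast
qed

text \<open>Infinitely many functions \<open>j\<close> and \<open>Q\<close> occur, but only their
  values on {1..k} enter the matrix, and these restrictions are finite in number. This gives meaning
  to the \<open>Min\<close> in \<open>min_minor\<close>.\<close>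

lemma finite_frac_minors:
  "finite {r. r > 0 \<and> (\<exists>k\<in>{1..d}. \<exists>j Q. index_choice d k j \<and>
     (\<forall>i\<in>{1..k}. Q i \<in> polys_le N) \<and> r = absK (mdet (frac_matrix k Q a j)))}" (is "finite ?M")
proof -
  have "?M \<subseteq> (\<Union>k\<in>{1..d}. (\<lambda>(j, Q). absK (mdet (frac_matrix k Q a j))) `
      ((PiE {1..k} (\<lambda>_. {1..d})) \<times> (PiE {1..k} (\<lambda>_. polys_le N))))"
  proof
    fix r assume "r \<in> ?M"
    then obtain k j Q where k: "k \<in> {1..d}" "index_choice d k j" "\<forall>i\<in>{1..k}. Q i \<in> polys_le N"
      "r = absK (mdet (frac_matrix k Q a j))" by blast
    have "frac_matrix k (restrict Q {1..k}) a (restrict j {1..k}) = frac_matrix k Q a j"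
      by (rule eq_matI) (auto simp: frac_matrix_def)
    moreover have "restrict j {1..k} \<in> PiE {1..k} (\<lambda>_. {1..d})"
      using k(2) unfolding index_choice_def by (intro restrict_PiE_iff[THEN iffD2]) blast
    moreover have "restrict Q {1..k} \<in> PiE {1..k} (\<lambda>_. polys_le N)"
      using k(3) by (intro restrict_PiE_iff[THEN iffD2])
    ultimately show "r \<in> (\<Union>k\<in>{1..d}. (\<lambda>(j, Q). absK (mdet (frac_matrix k Q a j))) `
      ((PiE {1..k} (\<lambda>_. {1..d})) \<times> (PiE {1..k} (\<lambda>_. polys_le N))))"
      using k(1,4) by (intro UN_I[OF k(1)] image_eqI[of _ _ "(restrict j {1..k}, restrict Q {1..k})"]) auto
  qed
  thus ?thesis by (rule finite_subset) (intro finite_UN_I finite_imageI finite_cartesian_product finite_PiE, auto)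
qed

lemma min_minor_le:
  assumes "k \<in> {1..d}" "index_choice d k j" "\<forall>i\<in>{1..k}. Q i \<in> polys_le N"
    "mdet (frac_matrix k Q a j) \<noteq> 0"
  shows "min_minor d a N \<le> absK (mdet (frac_matrix k Q a j))"
  unfolding min_minor_def
  by (rule Min_le[OF finite_frac_minors], intro CollectI conjI bexI[OF _ assms(1)] exI[of _ j] exI[of _ Q])
    (use assms in simp_all)

text \<open>For \<alpha> with coordinates \<open>a\<close> along a reduced basis \<open>v\<close>,
  this is the representative of Q \<alpha> modulo the lattice whose coordinates all lie in the
  maximal ideal.\<close>

definition frac_vector :: "(nat \<Rightarrow> 'a::{field,finite} fls ^ 'd) \<Rightarrow> (nat \<Rightarrow> 'a fls) \<Rightarrow> 'a poly \<Rightarrow> 'a fls ^ 'd" where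
  "frac_vector v a Q = (\<Sum>i=1..CARD('d). frac_part (poly_embed Q * a i) *s v i)"

text \<open>
  An element \<open>Q \<alpha> + u\<close> of the Kronecker set is the sum of \<open>frac_vector v a Q\<close> and an integral
  combination of the \<open>v i\<close>. By orthogonality no summand is longer than the element itself, so the
  fractional vectors and the \<open>v i\<close> have the same successive minima as the whole set.
\<close>

lemma unit_min_kronecker_set_eq:
  fixes g :: "'a::{field,finite} fls ^ 'd ^ 'd" and m :: "('a fls ^ 'd) measure" and N i :: nat
  assumes haar: "haar_measure m" and g: "invertible g" and v: "reduced_basis (lattice_of g) v"
    and \<alpha>: "\<alpha> = (\<Sum>i=1..CARD('d). a i *s v i)"
  defines "S \<equiv> kronecker_set (lattice_of g) \<alpha> N"
    and "T \<equiv> frac_vector v a ` polys_le N \<union> v ` {1..CARD('d)}"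
  shows "T \<subseteq> S" "vec.span T = UNIV" "unit_min S i = unit_min T i"
proof -
  let ?d = "CARD('d)"
  have vL: "v i \<in> lattice_of g" if "i \<in> {1..?d}" for i
    using v that by (simp add: reduced_basis_def)
  have int: "poly_embed Q *s \<alpha> - frac_vector v a Q =
      (\<Sum>i=1..?d. (poly_embed Q * a i - frac_part (poly_embed Q * a i)) *s v i)" for Q
    unfolding \<alpha> frac_vector_def
    by (simp add: vec.scale_sum_right vector_smult_assoc vec.scale_left_diff_distrib sum_subtractf)
  have "frac_vector v a Q \<in> S" if "Q \<in> polys_le N" for Q
  proof -
    have "frac_vector v a Q - poly_embed Q *s \<alpha> = - 1 *s (poly_embed Q *s \<alpha> - frac_vector v a Q)"
      by simp
    also have "\<dots> \<in> lattice_of g"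
      unfolding int by (intro lattice_of_scale lattice_of_sum diff_frac_part vL) (auto intro: ring_R_minus)
    finally show ?thesis
      unfolding S_def kronecker_set_def
      by (intro UN_I[OF that] image_eqI[of _ _ "frac_vector v a Q - poly_embed Q *s \<alpha>"]) auto
  qed
  moreover have "v i \<in> S" if "i \<in> {1..?d}" for i
    using vL[OF that] lattice_subset_kronecker_set unfolding S_def by blast
  ultimately show TS: "T \<subseteq> S" by (auto simp: T_def)
  \<comment> \<open>For every radius the bounded parts of \<open>S\<close> and \<open>T\<close> thus
    have the same span, so all minima agree at once.\<close>
  have sub: "S \<inter> {x. supnorm x \<le> r} \<subseteq> vec.span (T \<inter> {x. supnorm x \<le> r})" for r
  proof
    fix x assume "x \<in> S \<inter> {x. supnorm x \<le> r}"
    then obtain Q u where Q: "Q \<in> polys_le N" "u \<in> lattice_of g" "x = poly_embed Q *s \<alpha> + u" "supnorm x \<le> r"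
      by (auto simp: S_def kronecker_set_def)
    let ?f = "\<lambda>i. frac_part (poly_embed Q * a i)"
    have "poly_embed Q *s \<alpha> - frac_vector v a Q \<in> lattice_of g"
      unfolding int by (intro lattice_of_sum lattice_of_scale diff_frac_part vL)
    hence "(poly_embed Q *s \<alpha> - frac_vector v a Q) + u \<in> lattice_of g"
      using Q(2) by (rule lattice_of_add)
    hence "x - frac_vector v a Q \<in> lattice_of g"
      by (simp add: Q(3) diff_add_eq)
    then obtain n where n: "\<And>i. i \<in> {1..?d} \<Longrightarrow> n i \<in> ring_R"
      "x - frac_vector v a Q = (\<Sum>i=1..?d. n i *s v i)"
      using reduced_basis_integral[OF haar g v] by blast
    hence x: "x = frac_vector v a Q + (\<Sum>i=1..?d. n i *s v i)" by (simp add: algebra_simps)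
    hence x': "x = (\<Sum>i=1..?d. (?f i + n i) *s v i)"
      by (simp add: frac_vector_def vec.scale_left_distrib sum.distrib)
    have coord: "absK (?f i + n i) * supnorm (v i) \<le> r" if "i \<in> {1..?d}" for i
      using reduced_basis_orthogonal[OF haar g v that, of "\<lambda>i. ?f i + n i"] Q(4) by (simp add: x')
    \<comment> \<open>A nonzero polynomial has absolute value at least 1 and dominates the
      fractional part, so nothing cancels in coordinate i.\<close>
    have nz: "absK (n i) = absK (?f i + n i)" "1 \<le> absK (n i)" if "i \<in> {1..?d}" "n i \<noteq> 0" for i
    proof -
      show ge: "1 \<le> absK (n i)" using n(1) that by (intro ring_R_absK_ge_1)
      show "absK (n i) = absK (?f i + n i)"
        using absK_add_eq[of "?f i" "n i"] absK_frac_part[of "poly_embed Q * a i"] ge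
        by (simp add: add.commute)
    qed
    have "supnorm (?f i *s v i) \<le> r" if i: "i \<in> {1..?d}" for i
    proof -
      have "absK (?f i) \<le> absK (?f i + n i)"
        using nz[OF i] absK_frac_part[of "poly_embed Q * a i"] by (cases "n i = 0") auto
      hence "absK (?f i) * supnorm (v i) \<le> absK (?f i + n i) * supnorm (v i)"
        by (rule mult_right_mono) simp
      thus ?thesis using coord[OF i] by simp
    qed
    moreover have "0 \<le> r" using Q(4) supnorm_nonneg[of x] by linarith
    ultimately have "supnorm (frac_vector v a Q) \<le> r"
      unfolding frac_vector_def by (intro supnorm_sum_le)
    hence "frac_vector v a Q \<in> vec.span (T \<inter> {x. supnorm x \<le> r})"
      using Q(1) by (intro vec.span_base) (auto simp: T_def)
    moreover have "n i *s v i \<in> vec.span (T \<inter> {x. supnorm x \<le> r})" if i: "i \<in> {1..?d}" for i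
    proof (cases "n i = 0")
      case False
      \<comment> \<open>If \<open>v i\<close> really occurs, its total coefficient in x has absolute
        value at least 1; hence \<open>v i\<close> itself lies within radius r.\<close>
      have "1 * supnorm (v i) \<le> absK (?f i + n i) * supnorm (v i)"
        using nz[OF i False] by (intro mult_right_mono) auto
      hence "v i \<in> T \<inter> {x. supnorm x \<le> r}" using coord[OF i] i by (auto simp: T_def)
      thus ?thesis by (intro vec.span_scale vec.span_base)
    qed (simp add: vec.span_zero)
    ultimately show "x \<in> vec.span (T \<inter> {x. supnorm x \<le> r})"
      unfolding x by (intro vec.span_add vec.span_sum)
  qed
  have "vec.span (S \<inter> {x. supnorm x \<le> r}) = vec.span (T \<inter> {x. supnorm x \<le> r})" for r
    using sub[of r] TS by (intro equalityI vec.span_minimal vec.span_mono vec.subspace_span) auto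
  thus "unit_min S i = unit_min T i" by (simp add: unit_min_def)
  have "S \<subseteq> vec.span T"
  proof
    fix x assume "x \<in> S"
    hence "x \<in> vec.span (T \<inter> {y. supnorm y \<le> supnorm x})" using sub[of "supnorm x"] by auto
    thus "x \<in> vec.span T" using vec.span_mono[of "T \<inter> {y. supnorm y \<le> supnorm x}" T] by blast
  qed
  hence "vec.span S \<subseteq> vec.span T" by (intro vec.span_minimal vec.subspace_span)
  moreover have "vec.span S = UNIV"
    using vec.span_mono[OF lattice_subset_kronecker_set] span_lattice_of[OF g] unfolding S_def by blast
  ultimately show "vec.span T = UNIV" by blast
qed

text \<open>\<open>A\<close> holds the positions where a basis vector attains the minimum,
  \<open>I\<close> the others, and \<open>J\<close> the basis indices left free by \<open>A\<close>.
  The minor takes the polynomials of \<open>I\<close> against the coordinates in \<open>J\<close>. A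
  relation between its rows would put a combination of the fractional vectors into the span of the
  basis vectors already chosen, against independence of the minimal vectors.\<close>

lemma ex_minor_le_prod_unit_min:
  fixes g :: "'a::{field,finite} fls ^ 'd ^ 'd" and m :: "('a fls ^ 'd) measure"
  assumes haar: "haar_measure m" and g: "invertible g" and v: "reduced_basis (lattice_of g) v"
    and \<alpha>: "\<alpha> = (\<Sum>i=1..CARD('d). a i *s v i)" "\<alpha> \<noteq> 0"
    and nonint: "\<And>i. i \<in> {1..CARD('d)} \<Longrightarrow> a i \<in> ring_R \<Longrightarrow> a i = 0"
  shows "\<exists>k\<in>{1..CARD('d)}. \<exists>j Q. index_choice CARD('d) k j \<and> (\<forall>i\<in>{1..k}. Q i \<in> polys_le N) \<and>
    mdet (frac_matrix k Q a j) \<noteq> 0 \<and>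
    absK (mdet (frac_matrix k Q a j)) * absK (fdet g)
      \<le> (\<Prod>i=1..CARD('d). unit_min (kronecker_set (lattice_of g) \<alpha> N) i)"
proof -
  let ?d = "CARD('d)" and ?S = "kronecker_set (lattice_of g) \<alpha> N"
  define T where "T = frac_vector v a ` polys_le N \<union> v ` {1..?d}"
  note T = unit_min_kronecker_set_eq[OF haar g v \<alpha>(1), of N, folded T_def]
  have "locally_finite T"
    by (rule locally_finite_subset[OF locally_finite_kronecker_set[OF g] T(1)])
  then obtain t where t: "greedy T t" using ex_greedy T(2) by blast
  have prod_t: "(\<Prod>i=1..?d. unit_min ?S i) = (\<Prod>i=1..?d. supnorm (t i))"
    using unit_min_greedy[OF t] by (intro prod.cong) (auto simp: T(3))
  have vind: "vec.independent (v ` {1..?d})" "inj_on v {1..?d}" using v by (auto simp: reduced_basis_def)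
  have v0: "0 < supnorm (v i)" if "i \<in> {1..?d}" for i
    using vec.dependent_zero vind(1) that by (metis image_eqI supnorm_pos_iff)
  note tind = greedy_independent[OF t order_refl]
  \<comment> \<open>A vector of both kinds counts as a basis vector, so \<open>A\<close> and
    \<open>I\<close> partition the positions.\<close>
  define A where "A = {i \<in> {1..?d}. t i \<in> v ` {1..?d}}"
  define I where "I = {1..?d} - A"
  have "\<exists>j\<in>{1..?d}. t i = v j" if "i \<in> A" for i using that by (auto simp: A_def)
  then obtain \<sigma> where \<sigma>: "\<And>i. i \<in> A \<Longrightarrow> \<sigma> i \<in> {1..?d}" "\<And>i. i \<in> A \<Longrightarrow> t i = v (\<sigma> i)" by metis
  have "\<exists>Q\<in>polys_le N. t i = frac_vector v a Q" if "i \<in> I" for i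
  proof -
    have "t i \<in> T" using t that by (simp add: greedy_def I_def)
    thus ?thesis using that by (auto simp: T_def I_def A_def)
  qed
  then obtain R where R: "\<And>i. i \<in> I \<Longrightarrow> R i \<in> polys_le N" "\<And>i. i \<in> I \<Longrightarrow> t i = frac_vector v a (R i)"
    by metis
  have AI: "A \<subseteq> {1..?d}" "I \<subseteq> {1..?d}" "A \<union> I = {1..?d}" "A \<inter> I = {}"
    by (auto simp: A_def I_def)
  have fin: "finite A" "finite I" using AI finite_subset by blast+
  have inj\<sigma>: "inj_on \<sigma> A"
    using tind(2) \<sigma>(2) AI(1) by (metis (no_types, lifting) inj_onD inj_onI subsetD)
  define J where "J = {1..?d} - \<sigma> ` A"
  have \<sigma>A: "\<sigma> ` A \<subseteq> {1..?d}" using \<sigma>(1) by blast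
  have cardIJ: "card I = card J"
    using AI(1) \<sigma>A fin(1) by (simp add: I_def J_def card_Diff_subset card_image inj\<sigma>)
  have prod_split: "(\<Prod>i=1..?d. supnorm (t i)) = (\<Prod>i\<in>I. supnorm (t i)) * (\<Prod>j\<in>\<sigma> ` A. supnorm (v j))"
  proof -
    have "(\<Prod>i=1..?d. supnorm (t i)) = (\<Prod>i\<in>I. supnorm (t i)) * (\<Prod>i\<in>A. supnorm (t i))"
      using AI fin by (subst AI(3)[symmetric], subst prod.union_disjoint) auto
    moreover have "(\<Prod>i\<in>A. supnorm (t i)) = (\<Prod>j\<in>\<sigma> ` A. supnorm (v j))"
      by (simp add: prod.reindex[OF inj\<sigma>] \<sigma>(2))
    ultimately show ?thesis by simp
  qed
  have prod_v: "absK (fdet g) = (\<Prod>j\<in>J. supnorm (v j)) * (\<Prod>j\<in>\<sigma> ` A. supnorm (v j))"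
    unfolding prod_supnorm_reduced_basis[OF haar g v, symmetric] J_def
    by (rule prod.subset_diff[OF \<sigma>A]) simp
  show ?thesis
  proof (cases "card I = 0")
    \<comment> \<open>The minor would be empty, whereas k \<ge> 1 is demanded. But the product of
      the minima is now |det g|, so any nonzero fractional part, being smaller than 1, will do; Q =
      1 yields one at a nonzero coefficient.\<close>
    case True
    have "finite J" by (simp add: J_def)
    hence "I = {}" "J = {}" using True fin(2) cardIJ by simp_all
    hence eq: "(\<Prod>i=1..?d. unit_min ?S i) = absK (fdet g)" unfolding prod_t prod_split prod_v by simp
    have "\<exists>i\<in>{1..?d}. a i \<noteq> 0"
    proof (rule ccontr)
      assume "\<not> ?thesis"
      hence "\<alpha> = 0" unfolding \<alpha>(1) by (intro sum.neutral) auto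
      thus False using \<alpha>(2) by simp
    qed
    then obtain i where i: "i \<in> {1..?d}" "a i \<noteq> 0" by blast
    let ?F = "frac_matrix 1 (\<lambda>_. 1) a (\<lambda>_. i)"
    have det: "mdet ?F = frac_part (a i)"
      by (subst det_single) (simp_all add: frac_matrix_def)
    have "frac_part (a i) \<noteq> 0" using nonint[OF i(1)] i(2) diff_frac_part[of "a i"] by auto
    hence "mdet ?F \<noteq> 0" by (simp only: det not_False_eq_True)
    moreover have "absK (mdet ?F) * absK (fdet g) \<le> (\<Prod>i=1..?d. unit_min ?S i)"
      unfolding eq det using absK_frac_part[of "a i"] by (simp add: mult_left_le_one_le)
    moreover have "index_choice ?d 1 (\<lambda>_. i)" using i(1) by (simp add: index_choice_def strict_mono_on_def)
    moreover have "\<forall>i\<in>{1..1::nat}. (1 :: 'a poly) \<in> polys_le N" by (simp add: polys_le_def)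
    moreover have "1 \<in> {1..?d}" by simp
    ultimately show ?thesis
      by (intro bexI[of _ 1] exI[of _ "\<lambda>_. i"] exI[of _ "\<lambda>_. 1"] conjI)
  next
    case False
    define k where "k = card I"
    have "card I \<le> card {1..?d}" by (rule card_mono) (use AI in auto)
    hence k: "k \<in> {1..?d}" using False by (simp add: k_def)
    obtain j where j: "index_choice ?d k j" "bij_betw (\<lambda>l. j (Suc l)) {..<k} J"
      using ex_index_choice[of J ?d k] cardIJ by (auto simp: k_def J_def)
    obtain h where h: "bij_betw h {..<k} I"
      using finite_same_card_bij[of "{..<k}" I] fin(2) by (auto simp: k_def)
    \<comment> \<open>Row i of the 0-based matrix uses \<open>Q (Suc i)\<close>, that is
      \<open>R (h i)\<close>. The order in which \<open>h\<close> lists \<open>I\<close> affects the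
      minor only by a sign.\<close>
    define Q where "Q = (\<lambda>i. R (h (i - 1)))"
    have hI: "h i \<in> I" if "i < k" for i using h that by (auto simp: bij_betw_def)
    have jJ: "j (Suc l) \<in> J" if "l < k" for l using j(2) that by (auto simp: bij_betw_def)
    have QN: "\<forall>i\<in>{1..k}. Q i \<in> polys_le N" using R(1) hI by (auto simp: Q_def)
    let ?F = "frac_matrix k Q a j"
    have F: "?F $$ (i, l) = frac_part (poly_embed (R (h i)) * a (j (Suc l)))" if "i < k" "l < k" for i l
      using that by (simp add: frac_matrix_def Q_def)
    have det: "mdet ?F \<noteq> 0"
    proof
      assume "mdet ?F = 0"
      \<comment> \<open>A kernel vector of the transpose is a relation between the rows, that is
        between the fractional vectors restricted to the coordinates in \<open>J\<close>.\<close>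
      hence "mdet (transpose_mat ?F) = 0" by (simp add: Determinant.det_transpose[OF frac_matrix_carrier])
      then obtain y where y: "y \<in> carrier_vec k" "y \<noteq> 0\<^sub>v k" "transpose_mat ?F *\<^sub>v y = 0\<^sub>v k"
        using det_0_iff_vec_prod_zero[of "transpose_mat ?F" k] by auto
      have rel: "(\<Sum>i<k. vec_index y i * frac_part (poly_embed (R (h i)) * a (j (Suc l)))) = 0" if l: "l < k" for l
      proof -
        have "vec_index (transpose_mat ?F *\<^sub>v y) l = 0" using l y(3) by simp
        moreover have "dim_row ?F = k" "dim_col ?F = k" by (simp_all add: frac_matrix_def)
        ultimately show ?thesis
          using l y(1) by (simp add: scalar_prod_def F mult.commute atLeast0LessThan)
      qed
      define \<gamma> where "\<gamma> = (\<lambda>n. \<Sum>i<k. vec_index y i * frac_part (poly_embed (R (h i)) * a n))"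
      have \<gamma>J: "\<gamma> n = 0" if n: "n \<in> J" for n
      proof -
        obtain l where "l < k" "n = j (Suc l)" using n j(2) by (auto simp: bij_betw_def)
        thus ?thesis using rel by (simp add: \<gamma>_def)
      qed
      \<comment> \<open>The combination has coefficients \<gamma>, which vanish on \<open>J\<close>,
        so it is supported on basis vectors that occur among the t. Subtracting these gives a
        relation between all t.\<close>
      define c where "c = (\<lambda>i. if i \<in> I then vec_index y (inv_into {..<k} h i) else - \<gamma> (\<sigma> i))"
      have "(\<Sum>i\<in>I. c i *s t i) = (\<Sum>i<k. vec_index y i *s t (h i))"
        using h by (subst sum.reindex_bij_betw[OF h, symmetric])
          (auto simp: c_def bij_betw_def hI intro!: sum.cong)
      also have "\<dots> = (\<Sum>i<k. \<Sum>n=1..?d. (vec_index y i * frac_part (poly_embed (R (h i)) * a n)) *s v n)"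
        by (intro sum.cong refl)
          (simp add: R(2)[OF hI] frac_vector_def vec.scale_sum_right vector_smult_assoc)
      also have "\<dots> = (\<Sum>n=1..?d. \<gamma> n *s v n)"
        unfolding \<gamma>_def vec.scale_sum_left by (rule sum.swap)
      also have "\<dots> = (\<Sum>n\<in>\<sigma> ` A. \<gamma> n *s v n)"
        using \<sigma>A \<gamma>J by (intro sum.mono_neutral_right) (auto simp: J_def)
      also have "\<dots> = (\<Sum>i\<in>A. \<gamma> (\<sigma> i) *s t i)"
        by (simp add: sum.reindex[OF inj\<sigma>] \<sigma>(2))
      also have "\<dots> = - (\<Sum>i\<in>A. c i *s t i)"
        using AI(4) by (auto simp: c_def sum_negf[symmetric] intro!: sum.cong)
      finally have "(\<Sum>i\<in>I. c i *s t i) + (\<Sum>i\<in>A. c i *s t i) = 0" by simp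
      hence "(\<Sum>i=1..?d. c i *s t i) = 0"
        using AI fin by (subst AI(3)[symmetric], subst sum.union_disjoint) (auto simp: add.commute)
      hence c0: "c i = 0" if "i \<in> {1..?d}" for i
        using independent_family[OF tind] that by blast
      have "vec_index y i = 0" if "i < k" for i
        using c0[of "h i"] hI[OF that] AI(2) h that by (auto simp: c_def bij_betw_def)
      hence "y = 0\<^sub>v k" using y(1) by (intro eq_vecI) auto
      thus False using y(2) by simp
    qed
    have "absK (mdet ?F) * (\<Prod>l<k. supnorm (v (j (Suc l)))) \<le> (\<Prod>i<k. supnorm (t (h i)))"
    proof (rule absK_mdet_mult_le)
      show "?F \<in> carrier_mat k k" by simp
      fix i l assume il: "i < k" "l < k"
      have "j (Suc l) \<in> {1..?d}" using jJ[OF il(2)] by (simp add: J_def)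
      \<comment> \<open>Orthogonality: a single coordinate of a fractional vector, times the length
        of its basis vector, is at most the length of the whole vector.\<close>
      from reduced_basis_orthogonal[OF haar g v this, of "\<lambda>n. frac_part (poly_embed (R (h i)) * a n)"]
      show "absK (?F $$ (i, l)) * supnorm (v (j (Suc l))) \<le> supnorm (t (h i))"
        unfolding F[OF il] R(2)[OF hI[OF il(1)]] frac_vector_def .
    next
      fix l assume "l < k"
      thus "0 < supnorm (v (j (Suc l)))" using jJ v0 by (simp add: J_def)
    qed
    hence "absK (mdet ?F) * (\<Prod>n\<in>J. supnorm (v n)) \<le> (\<Prod>i\<in>I. supnorm (t i))"
      by (simp only: prod.reindex_bij_betw[OF j(2), of "\<lambda>n. supnorm (v n)"]
          prod.reindex_bij_betw[OF h, of "\<lambda>i. supnorm (t i)"])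
    \<comment> \<open>The lengths of the basis vectors chosen in \<open>A\<close> complete one side
      to |det g| and the other to the product of all minima.\<close>
    hence "absK (mdet ?F) * (\<Prod>n\<in>J. supnorm (v n)) * (\<Prod>n\<in>\<sigma> ` A. supnorm (v n))
        \<le> (\<Prod>i\<in>I. supnorm (t i)) * (\<Prod>n\<in>\<sigma> ` A. supnorm (v n))"
      by (rule mult_right_mono) (intro prod_nonneg, simp)
    hence "absK (mdet ?F) * absK (fdet g) \<le> (\<Prod>i=1..?d. unit_min ?S i)"
      unfolding prod_t prod_split prod_v by (simp only: mult.assoc)
    thus ?thesis using k j(1) QN det by blast
  qed
qed

subsection \<open>Arbitrary convex bodies\<close>

lemma matrix_image_lattice_of: "(*v) B ` lattice_of g = lattice_of (B ** g)"
  by (simp add: lattice_of_def image_image matrix_vector_mul_assoc)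

lemma matrix_image_kronecker_set:
  fixes B :: "'a::{field,finite} fls ^ 'd ^ 'd"
  shows "(*v) B ` kronecker_set L \<alpha> N = kronecker_set ((*v) B ` L) (B *v \<alpha>) N"
  by (simp add: kronecker_set_def image_UN image_image matrix_vector_right_distrib vector_scalar_commute)

lemma succ_min_basis_imp_reduced_basis:
  fixes h :: "'a::{field,finite} fls ^ 'd ^ 'd"
  assumes h: "invertible h" and v: "succ_min_basis h L v"
  shows "reduced_basis ((*v) (matrix_inv h) ` L) (\<lambda>i. matrix_inv h *v v i)"
proof -
  let ?B = "matrix_inv h"
  have inj: "inj ((*v) ?B)"
    by (metis h inj_on_inverseI matrix_inv_cancel_vec(1))
  have indep: "vec.independent (v ` {1..CARD('d)})" and injv: "inj_on v {1..CARD('d)}"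
    using v unfolding succ_min_basis_def by blast+
  have "vec.independent ((*v) ?B ` (v ` {1..CARD('d)}))"
    by (rule vec.independent_inj_image[OF indep inj])
  moreover have "inj_on (\<lambda>i. ?B *v v i) {1..CARD('d)}"
    using comp_inj_on[OF injv inj_on_subset[OF inj subset_UNIV]] by (simp add: comp_def)
  ultimately show ?thesis
    using v h
    by (simp add: reduced_basis_def succ_min_basis_def image_image body_norm_def succ_min_eq_unit_min)
qed

text \<open>Comparing coordinates along the basis, each Q a_i is a polynomial and hence 0 by
  \<open>nonint\<close>. For nonzero Q all a_i would vanish, contrary to \<alpha> \<noteq>
  0.\<close>

lemma poly_multiple_in_lattice_imp_0:
  fixes g :: "'a::{field,finite} fls ^ 'd ^ 'd" and m :: "('a fls ^ 'd) measure"
  assumes haar: "haar_measure m" and g: "invertible g" and v: "reduced_basis (lattice_of g) v"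
    and \<alpha>: "\<alpha> = (\<Sum>i=1..CARD('d). a i *s v i)" "\<alpha> \<noteq> 0"
    and nonint: "\<And>i. i \<in> {1..CARD('d)} \<Longrightarrow> poly_embed Q * a i \<in> ring_R \<Longrightarrow> poly_embed Q * a i = 0"
    and Q: "poly_embed Q *s \<alpha> \<in> lattice_of g"
  shows "Q = 0"
proof (rule ccontr)
  let ?d = "CARD('d)"
  assume "Q \<noteq> 0"
  obtain n where n: "\<And>i. i \<in> {1..?d} \<Longrightarrow> n i \<in> ring_R" "poly_embed Q *s \<alpha> = (\<Sum>i=1..?d. n i *s v i)"
    using reduced_basis_integral[OF haar g v Q] by blast
  have "(\<Sum>i=1..?d. (poly_embed Q * a i - n i) *s v i) = poly_embed Q *s \<alpha> - (\<Sum>i=1..?d. n i *s v i)"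
    unfolding \<alpha>(1)
    by (simp add: vec.scale_sum_right vector_smult_assoc vec.scale_left_diff_distrib sum_subtractf)
  hence zero: "(\<Sum>i=1..?d. (poly_embed Q * a i - n i) *s v i) = 0" using n(2) by simp
  have "a i = 0" if i: "i \<in> {1..?d}" for i
  proof -
    have "poly_embed Q * a i - n i = 0"
      using v i by (intro independent_family[OF _ _ _ zero i]) (auto simp: reduced_basis_def)
    hence "poly_embed Q * a i = 0" using nonint[OF i] n(1)[OF i] by simp
    thus ?thesis using \<open>Q \<noteq> 0\<close> by simp
  qed
  hence "\<alpha> = 0" unfolding \<alpha>(1) by (intro sum.neutral) auto
  thus False using \<alpha>(2) by simp
qed

theorem theorem1p7:
  fixes g h :: "'a::{field,finite} fls ^ 'd ^ 'd"
    and L :: "('a fls ^ 'd) set"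
    and C :: "('a fls ^ 'd) set"
    and v :: "nat \<Rightarrow> 'a fls ^ 'd"
    and a :: "nat \<Rightarrow> 'a fls"
    and \<alpha> :: "'a fls ^ 'd"
    and N :: nat
    and m :: "('a fls ^ 'd) measure"
  assumes "CARD('d) \<ge> 2"
    and "haar_measure m"
    and "invertible g" and "L = lattice_of g"
    and "invertible h" and "C = convex_body h"
    and "succ_min_basis (Finite_Cartesian_Product.mat 1) L v \<or> succ_min_basis h L v"
    and "\<alpha> = (\<Sum>i=1..CARD('d). a i *s v i)"
    and "\<forall>i\<in>{1..CARD('d)}. (\<lambda>Q. poly_embed Q * a i) ` polys_le N \<inter> ring_R = {0}"
    and "\<alpha> \<noteq> 0"
  shows "(succ_min_basis h L v \<longrightarrow>
           min_minor CARD('d) a N * (lattice_det g / measure m C)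
             \<le> (\<Prod>i=1..CARD('d). succ_min h (kronecker_set L \<alpha> N) i)) \<and>
         (\<Prod>i=1..CARD('d). succ_min h (kronecker_set L \<alpha> N) i)
           \<le> lattice_det g / (real CARD('a) ^ (N + 1) * measure m C) \<and>
         (\<exists>k\<in>{1..CARD('d)}. \<exists>l Q. index_choice CARD('d) k l \<and>
           (\<forall>i\<in>{1..k}. Q i \<in> polys_le N) \<and>
           0 \<noteq> absK (Determinant.det (transpose_mat (frac_matrix k Q a l))) \<and>
           absK (Determinant.det (transpose_mat (frac_matrix k Q a l)))
             \<le> 1 / real CARD('a) ^ (N + 1))"
proof -
  let ?d = "CARD('d)" and ?q = "real CARD('a)"
  have haar: "haar_measure m" and g: "invertible g" and h: "invertible h" and L: "L = lattice_of g"
    and \<alpha>: "\<alpha> = (\<Sum>i=1..?d. a i *s v i)" and \<alpha>0: "\<alpha> \<noteq> 0"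
    using assms by auto
  have nonint: "poly_embed Q * a i = 0"
    if "Q \<in> polys_le N" "i \<in> {1..?d}" "poly_embed Q * a i \<in> ring_R" for Q i
    using assms(9) that by blast
  have nonint1: "a i = 0" if "i \<in> {1..?d}" "a i \<in> ring_R" for i
    using nonint[of 1 i] that by (simp add: polys_le_def)

  \<comment> \<open>Stated for a variable body, since the given \<open>h\<close> and the body whose
    minima the basis realises may differ.\<close>
  have normalised: "invertible (matrix_inv B ** g)"
      "(*v) (matrix_inv B) ` L = lattice_of (matrix_inv B ** g)"
      "matrix_inv B *v \<alpha> = (\<Sum>i=1..?d. a i *s (matrix_inv B *v v i))"
      "matrix_inv B *v \<alpha> \<noteq> 0"
      "succ_min B (kronecker_set L \<alpha> N) i =
         unit_min (kronecker_set (lattice_of (matrix_inv B ** g)) (matrix_inv B *v \<alpha>) N) i"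
      "absK (fdet (matrix_inv B ** g)) = absK (fdet g) / absK (fdet B)"
    if B: "invertible B" for B :: "'a fls ^ 'd ^ 'd" and i
  proof -
    show "invertible (matrix_inv B ** g)"
      using g invertible_matrix_inv[OF B] by (simp add: invertible_mult)
    show im: "(*v) (matrix_inv B) ` L = lattice_of (matrix_inv B ** g)"
      unfolding L by (rule matrix_image_lattice_of)
    show "matrix_inv B *v \<alpha> = (\<Sum>i=1..?d. a i *s (matrix_inv B *v v i))"
      unfolding \<alpha> by (simp add: vec.sum vector_scalar_commute)
    show "matrix_inv B *v \<alpha> \<noteq> 0"
      using \<alpha>0 by (metis B matrix_inv_cancel_vec(1) matrix_vector_mult_0_right)
    show "succ_min B (kronecker_set L \<alpha> N) i =
         unit_min (kronecker_set (lattice_of (matrix_inv B ** g)) (matrix_inv B *v \<alpha>) N) i"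
      unfolding succ_min_eq_unit_min[OF B] matrix_image_kronecker_set im ..
    show "absK (fdet (matrix_inv B ** g)) = absK (fdet g) / absK (fdet B)"
      by (simp add: det_mul absK_det_matrix_inv[OF B] divide_inverse mult.commute)
  qed

  define P where "P = (\<lambda>B. \<Prod>i=1..?d. succ_min B (kronecker_set L \<alpha> N) i)"
  have reduced: "reduced_basis (lattice_of (matrix_inv B ** g)) (\<lambda>i. matrix_inv B *v v i)"
    if "invertible B" "succ_min_basis B L v" for B
    using succ_min_basis_imp_reduced_basis[OF that] normalised(2)[OF that(1)] by simp

  \<comment> \<open>Either the identity matrix or \<open>h\<close>, according to the alternative
    assumed for the basis.\<close>
  obtain b where b: "invertible b" "succ_min_basis b L v"
    using assms(7) h by (metis invertible_def matrix_mul_lid)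
  \<comment> \<open>Proved in the coordinates of \<open>b\<close>, where the basis is known to
    generate the lattice. The conclusion mentions only \<open>L\<close> and \<alpha>, so it serves
    the upper bound for every body.\<close>
  have distinct: "Q = 0" if "Q \<in> polys_le N" "poly_embed Q *s \<alpha> \<in> L" for Q
  proof (rule poly_multiple_in_lattice_imp_0[OF haar normalised(1)[OF b(1)] reduced[OF b]
        normalised(3,4)[OF b(1)]])
    show "poly_embed Q *s (matrix_inv b *v \<alpha>) \<in> lattice_of (matrix_inv b ** g)"
      unfolding normalised(2)[OF b(1), symmetric] vector_scalar_commute[symmetric] using that(2) by blast
  qed (use nonint[OF that(1)] in auto)

  have upper: "?q ^ (N + 1) * P B \<le> absK (fdet g) / absK (fdet B)" if B: "invertible B" for B
    unfolding P_def normalised(5)[OF B] normalised(6)[OF B, symmetric]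
  proof (rule prod_unit_min_kronecker_set_le[OF haar normalised(1)[OF B]])
    fix Q assume Q: "Q \<in> polys_le N"
      "poly_embed Q *s (matrix_inv B *v \<alpha>) \<in> lattice_of (matrix_inv B ** g)"
    then obtain x where "x \<in> L" "matrix_inv B *v (poly_embed Q *s \<alpha>) = matrix_inv B *v x"
      unfolding normalised(2)[OF B, symmetric] vector_scalar_commute[symmetric] by blast
    hence "poly_embed Q *s \<alpha> \<in> L" by (metis B matrix_inv_cancel_vec(1))
    thus "Q = 0" by (rule distinct[OF Q(1)])
  qed
  have lower: "\<exists>k\<in>{1..?d}. \<exists>j Q. index_choice ?d k j \<and> (\<forall>i\<in>{1..k}. Q i \<in> polys_le N) \<and>
      mdet (frac_matrix k Q a j) \<noteq> 0 \<and>
      absK (mdet (frac_matrix k Q a j)) * (absK (fdet g) / absK (fdet B)) \<le> P B"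
    if B: "invertible B" "succ_min_basis B L v" for B
    unfolding P_def normalised(5)[OF B(1)] normalised(6)[OF B(1), symmetric]
    by (rule ex_minor_le_prod_unit_min[OF haar normalised(1)[OF B(1)] reduced[OF B]
        normalised(3,4)[OF B(1)] nonint1])

  have q: "0 < ?q ^ (N + 1)" by simp
  have detg: "0 < absK (fdet g)" using g by (simp add: invertible_det_nz)
  have measC: "measure m C = absK (fdet h)" unfolding assms(6) by (rule measure_convex_body[OF haar h])
  have deth: "0 < absK (fdet h)" using h by (simp add: invertible_det_nz)
  have "min_minor ?d a N * (lattice_det g / measure m C) \<le> P h" if basis: "succ_min_basis h L v"
  proof -
    obtain k j Q where kjQ: "k \<in> {1..?d}" "index_choice ?d k j" "\<forall>i\<in>{1..k}. Q i \<in> polys_le N"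
      "mdet (frac_matrix k Q a j) \<noteq> 0"
      "absK (mdet (frac_matrix k Q a j)) * (absK (fdet g) / absK (fdet h)) \<le> P h"
      using lower[OF h basis] by blast
    have "min_minor ?d a N * (absK (fdet g) / absK (fdet h)) \<le>
        absK (mdet (frac_matrix k Q a j)) * (absK (fdet g) / absK (fdet h))"
      by (rule mult_right_mono[OF min_minor_le[OF kjQ(1-4)]]) simp
    thus ?thesis using kjQ(5) by (simp add: lattice_det_def measC)
  qed
  moreover have "P h \<le> lattice_det g / (?q ^ (N + 1) * measure m C)"
    using upper[OF h] q deth by (simp add: lattice_det_def measC field_simps)
  moreover have "\<exists>k\<in>{1..?d}. \<exists>l Q. index_choice ?d k l \<and> (\<forall>i\<in>{1..k}. Q i \<in> polys_le N) \<and>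
      0 \<noteq> absK (mdet (transpose_mat (frac_matrix k Q a l))) \<and>
      absK (mdet (transpose_mat (frac_matrix k Q a l))) \<le> 1 / ?q ^ (N + 1)"
  proof -
    obtain k j Q where kjQ: "k \<in> {1..?d}" "index_choice ?d k j" "\<forall>i\<in>{1..k}. Q i \<in> polys_le N"
      "mdet (frac_matrix k Q a j) \<noteq> 0"
      "absK (mdet (frac_matrix k Q a j)) * (absK (fdet g) / absK (fdet b)) \<le> P b"
      using lower[OF b] by blast
    \<comment> \<open>Both bounds are taken in the body \<open>b\<close>, so the ratio
      \<open>?G\<close> cancels and only the minor and q^(N+1) remain.\<close>
    let ?D = "absK (mdet (frac_matrix k Q a j))" and ?G = "absK (fdet g) / absK (fdet b)"
    have "0 < ?G" using detg b(1) by (simp add: invertible_det_nz)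
    moreover have "?q ^ (N + 1) * ?D * ?G \<le> 1 * ?G"
      using mult_left_mono[OF kjQ(5), of "?q ^ (N + 1)"] upper[OF b(1)] by (simp add: mult.assoc)
    ultimately have "?q ^ (N + 1) * ?D \<le> 1" by (simp only: mult_le_cancel_right_pos)
    hence "?D \<le> 1 / ?q ^ (N + 1)" using q by (simp only: pos_le_divide_eq mult.commute)
    moreover have "mdet (transpose_mat (frac_matrix k Q a j)) = mdet (frac_matrix k Q a j)"
      by (rule Determinant.det_transpose[OF frac_matrix_carrier])
    ultimately show ?thesis
      using kjQ(4) by (intro bexI[OF _ kjQ(1)] exI[of _ j] exI[of _ Q] conjI kjQ(2,3)) simp_all
  qed
  ultimately show ?thesis unfolding P_def by blast
qed

end
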